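(* Let $\mu$ be the Bernoulli product measure on $\Omega=\{-1,1\}^{\mathbb{Z}}$ with $\mu\{\omega:\omega_0=1\}=p>1/2$, let $\rho=p^{-1}(1-p)$, and let $T$, $\Omega^*$, $s_0$, $\varphi:\Omega^*\to\mathbb{N}^{\mathbb{Z}}$, $(\varphi\omega)_k=s_0(T^k\omega)$, the shift $\theta$ on $\mathbb{N}^{\mathbb{Z}}$, and the product measure $\gamma$ on $\mathbb{N}^{\mathbb{Z}}$ be as defined in the context. Then: (i) $\mu\circ\varphi^{-1}=\gamma$. (ii) Almost every $\omega\in\Omega^*$ is uniquely determined by $\varphi\omega$; that is, there is a measurable set $\Omega_0\subset\Omega^*$ with $\mu(\Omega_0)=1$ on which $\varphi$ is injective. (iii) $T=\varphi^{-1}\circ\theta\circ\varphi$ $\mu$-almost everywhere.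
   Context: $\mathbb{N}=\{0,1,2,\dots\}$. Let $\Omega=\{-1,1\}^{\mathbb{Z}}$ with its product $\sigma$-algebra, and let $\mu$ be the product measure under which the coordinates $\omega_n$, $n\in\mathbb{Z}$, are i.i.d. with $\mu\{\omega_0=1\}=p$, $\mu\{\omega_0=-1\}=1-p$, where $p>1/2$. Put $\rho=p^{-1}(1-p)$. For $\omega\in\Omega$ define the two-sided walk $x=(x_n,n\in\mathbb{Z})$ by $x_0=0$, $x_n=x_{n-1}+\omega_n$ for $n>0$, and $x_n=x_{n+1}-\omega_{n+1}$ for $n<0$. For $n\in\mathbb{Z}$ let $s_n=s_n(\omega)=\sup_{m\le n}x_m$. Let $\Omega'=\{\omega\in\Omega: s_0(\omega)<\infty\}$; then $\mu(\Omega')=1$. For $\omega\in\Omega'$ put $y_n=2s_n-x_n$ and define $T:\Omega'\to\Omega$ by $(T\omega)_n=y_n-y_{n-1}$, $n\in\mathbb{Z}$. Let $\Omega''=\{\omega\in\Omega':\liminf_{n\to\infty}(s_n-x_n)=0\}$ (so $\mu(\Omega'')=1$) and let $R:\Omega\to\Omega$ be the time reversal $(R\omega)_n=\omega_{-n}$. It is known that $T$ preserves $\mu$, i.e. $\mu\circ T^{-1}=\mu$, and that $\omega=(RTR)(T\omega)$ for all $\omega\in\Omega''$. Consequently there is a measurable set $\Omega^*\subset\Omega''$ with $\mu(\Omega^* )=1$ which $T$ maps bijectively onto itself with inverse $T^{-1}=RTR$, so that $T^k$ is defined on $\Omega^*$ for all $k\in\mathbb{Z}$. Fix such a set $\Omega^*$.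 Define $\varphi:\Omega^*\to\mathbb{N}^{\mathbb{Z}}$ by $(\varphi\omega)_k=s_0(T^k\omega)$, $k\in\mathbb{Z}$. Let $\theta$ be the shift on $\mathbb{N}^{\mathbb{Z}}$, $(\theta\alpha)_k=\alpha_{k+1}$, and let $\gamma$ be the ($\theta$-invariant) product measure on $\mathbb{N}^{\mathbb{Z}}$, with i.i.d. coordinates, such that $\gamma\{\alpha\in\mathbb{N}^{\mathbb{Z}}:\alpha_0=x\}=(1-\rho)\rho^x$ for integers $x\ge 0$ (with $0^0=1$). In (iii), $\varphi^{-1}$ denotes the almost everywhere defined inverse of $\varphi$ provided by (i) and (ii). *)

theory Defs
  imports "HOL-Probability.Probability"
begin

definition Omega :: "(int \<Rightarrow> int) set" where
  "Omega = (\<Pi>\<^sub>E n\<in>UNIV. {-1, 1})"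

definition step_measure :: "real \<Rightarrow> int measure" where
  "step_measure p = point_measure {-1, 1} (\<lambda>a. ennreal (if a = 1 then p else 1 - p))"

definition mu :: "real \<Rightarrow> (int \<Rightarrow> int) measure" where
  "mu p = (\<Pi>\<^sub>M n\<in>UNIV. step_measure p)"

definition rho :: "real \<Rightarrow> real" where
  "rho p = inverse p * (1 - p)"

function walk :: "(int \<Rightarrow> int) \<Rightarrow> int \<Rightarrow> int" where
  "walk \<omega> n =
     (if n = 0 then 0
      else if n > 0 then walk \<omega> (n - 1) + \<omega> n
      else walk \<omega> (n + 1) - \<omega> (n + 1))"
  by auto
termination by (relation "Wellfounded.measure (\<lambda>(_, n). nat \<bar>n\<bar>)") auto

declare walk.simps [simp del]

text \<open>The supremum is taken in the conditionally complete order of the integers, so it is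
  meaningful only when the walk is bounded above on the left half-line, that is on
  \<open>Omega1\<close>; the lemma \<open>mem_Omega1_iff\<close> states that condition with an extended real supremum.\<close>

definition run_sup :: "(int \<Rightarrow> int) \<Rightarrow> int \<Rightarrow> int" where
  "run_sup \<omega> n = (SUP m\<in>{..n}. walk \<omega> m)"

definition Omega1 :: "(int \<Rightarrow> int) set" where
  "Omega1 = {\<omega> \<in> Omega. bdd_above (walk \<omega> ` {..0})}"

definition reflected :: "(int \<Rightarrow> int) \<Rightarrow> int \<Rightarrow> int" where
  "reflected \<omega> n = 2 * run_sup \<omega> n - walk \<omega> n"

text \<open>The transformation \<open>T\<close>, to be used on \<open>Omega1\<close> only.\<close>

definition pitman :: "(int \<Rightarrow> int) \<Rightarrow> int \<Rightarrow> int" where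
  "pitman \<omega> n = reflected \<omega> n - reflected \<omega> (n - 1)"

definition Omega2 :: "(int \<Rightarrow> int) set" where
  "Omega2 = {\<omega> \<in> Omega1.
     liminf (\<lambda>n::nat. ereal (real_of_int (run_sup \<omega> (int n) - walk \<omega> (int n)))) = 0}"

definition time_rev :: "(int \<Rightarrow> int) \<Rightarrow> int \<Rightarrow> int" where
  "time_rev \<omega> n = \<omega> (- n)"

definition pitman_inv :: "(int \<Rightarrow> int) \<Rightarrow> int \<Rightarrow> int" where
  "pitman_inv = time_rev \<circ> pitman \<circ> time_rev"

text \<open>The integer power \<open>T\<^sup>k\<close>. Negative powers iterate \<open>R T R\<close>, which is the inverse of \<open>T\<close> on
  the invariant sets considered here.\<close>

definition pitman_pow :: "int \<Rightarrow> (int \<Rightarrow> int) \<Rightarrow> int \<Rightarrow> int" where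
  "pitman_pow k = (if k \<ge> 0 then pitman ^^ nat k else pitman_inv ^^ nat (- k))"

text \<open>On \<open>Omega1\<close> the conversion by \<open>nat\<close> loses nothing, because \<open>run_sup \<omega> 0 \<ge> walk \<omega> 0 = 0\<close>.\<close>

definition phi :: "(int \<Rightarrow> int) \<Rightarrow> int \<Rightarrow> nat" where
  "phi \<omega> k = nat (run_sup (pitman_pow k \<omega>) 0)"

definition theta :: "(int \<Rightarrow> nat) \<Rightarrow> int \<Rightarrow> nat" where
  "theta \<alpha> k = \<alpha> (k + 1)"

text \<open>For \<open>1/2 < p \<le> 1\<close> the marginals give mass \<open>(1 - rho p) * rho p ^ x\<close> to \<open>x\<close>,
  see \<open>pmf_geometric_rho\<close>.\<close>

definition gamma :: "real \<Rightarrow> (int \<Rightarrow> nat) measure" where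
  "gamma p = (\<Pi>\<^sub>M k\<in>UNIV. measure_pmf (geometric_pmf (1 - rho p)))"

lemma space_mu: "space (mu p) = Omega"
  by (simp add: mu_def Omega_def step_measure_def space_PiM space_point_measure)

lemma prob_space_step_measure:
  assumes "0 \<le> p" "p \<le> 1"
  shows "prob_space (step_measure p)"
  using assms
  by (intro prob_spaceI)
     (simp add: step_measure_def space_point_measure emeasure_point_measure_finite
        flip: ennreal_plus)

lemma mem_Omega1_iff:
  "\<omega> \<in> Omega1 \<longleftrightarrow> \<omega> \<in> Omega \<and> (SUP m\<in>{..0}. ereal (real_of_int (walk \<omega> m))) < \<infinity>"
proof -
  have "bdd_above (walk \<omega> ` {..0}) \<longleftrightarrow> (SUP m\<in>{..0}. ereal (real_of_int (walk \<omega> m))) < \<infinity>"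
    (is "?B \<longleftrightarrow> ?S < \<infinity>")
  proof
    assume ?B
    then obtain c where c: "\<And>m. m \<le> 0 \<Longrightarrow> walk \<omega> m \<le> c"
      by (auto simp: bdd_above_def)
    have "?S \<le> ereal (real_of_int c)"
      by (intro SUP_least) (simp add: c)
    then show "?S < \<infinity>"
      by (rule le_less_trans) simp
  next
    assume "?S < \<infinity>"
    then obtain r where r: "?S < ereal r"
      by (auto simp: less_PInf_Ex_of_nat)
    have "walk \<omega> m \<le> \<lfloor>r\<rfloor>" if "m \<le> 0" for m
    proof -
      have "ereal (real_of_int (walk \<omega> m)) \<le> ?S"
        using that by (intro SUP_upper) auto
      with r have "ereal (real_of_int (walk \<omega> m)) < ereal r"
        by (rule le_less_trans[rotated])
      then show ?thesis by (simp add: le_floor_iff)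
    qed
    then show ?B by (intro bdd_aboveI[of _ "\<lfloor>r\<rfloor>"]) auto
  qed
  then show ?thesis by (simp add: Omega1_def)
qed

lemma pmf_geometric_rho:
  assumes "1/2 < p" "p \<le> 1"
  shows "pmf (geometric_pmf (1 - rho p)) x = (1 - rho p) * rho p ^ x"
proof -
  have "0 < 1 - rho p" "1 - rho p \<le> 1"
    using assms by (simp_all add: rho_def field_simps)
  then show ?thesis by simp
qed

end

theory Submission
  imports Defs
begin

text \<open>The walk is read as a single-server queue. A step \<open>-1\<close> at time \<open>n\<close> is an arrival, a step \<open>1\<close> is a
service, which is wasted when nobody waits, and \<open>s\<^sub>n - x\<^sub>n\<close> is the number of waiting customers after
time \<open>n\<close>. In these terms \<open>(T \<omega>)\<^sub>n = -1\<close> holds exactly when a customer departs at time \<open>n\<close>. So the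
sequence \<open>(T\<^sup>k \<omega>)\<close>, \<open>k \<in> \<int>\<close>, describes queues in tandem, the departures of queue \<open>k\<close> being the
arrivals at queue \<open>k + 1\<close>, and \<open>\<phi> \<omega>\<close> lists all queue lengths at time \<open>0\<close>.

\<^emph>\<open>Law of \<open>\<phi>\<close>.\<close> The length of a single queue is a stationary Markov chain, and its balance equations
force the geometric law (\<open>prob_queue_length\<close>). One time step sends the pair (length before, step) to
the pair (length after, output). This map is a bijection that preserves the product of the
geometric law and the step law. By induction over time, the length at time \<open>n\<close> is therefore
independent of the outputs up to time \<open>n\<close>, and these outputs are again i.i.d. steps: this is
Burke's theorem (\<open>prob_queue_length_partial_departures\<close>). It contains the invariance of \<open>\<mu>\<close> under
\<open>T\<close>. Moreover all later queues at time \<open>n\<close> are functions of the outputs up to time \<open>n\<close>, so the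
lengths of consecutive queues at time \<open>n\<close> are independent (\<open>prob_tandem_queue_lengths\<close>). Invariance
under powers of \<open>T\<close> lets the tandem begin at any negative index, which gives \<open>\<gamma>\<close> as the law of the
two-sided sequence, at every time \<open>n\<close> (\<open>distr_mu_tandem_lengths\<close>).

\<^emph>\<open>Injectivity.\<close> Given the lengths at time \<open>n\<close>, an empty queue emits \<open>1\<close> at time \<open>n + 1\<close> whatever
happens upstream, and a nonempty queue flips the sign of its input. Hence the steps of time \<open>n + 1\<close>
at all queues are determined as soon as there are empty queues arbitrarily far to the left, and
with them the lengths at time \<open>n + 1\<close>. Backwards in time, a queue that is empty after time \<open>n\<close> has
received \<open>1\<close> at time \<open>n\<close>, and a nonempty one has flipped its input; so empty queues arbitrarily far
to the right determine the steps of time \<open>n\<close> and the lengths at time \<open>n - 1\<close>. Almost surely there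
are such empty queues at all times, since the lengths at each time are i.i.d. This reconstruction
is the measurable map \<open>decode\<close> (\<open>decode_tandem\<close>).

\<^emph>\<open>Conjugacy.\<close> The identity \<open>\<theta> (\<phi> \<omega>) = \<phi> (T \<omega>)\<close> is immediate. Since \<open>decode\<close> inverts \<open>\<phi>\<close> explicitly, the
image under \<open>\<phi>\<close> of a set \<open>A\<close> of full measure contains a measurable set of full \<open>\<gamma>\<close>-measure: the
sequences that \<open>decode\<close> sends into \<open>A\<close> and \<open>\<phi>\<close> sends back.\<close>

section \<open>The walk as a queue\<close>

text \<open>A version of \<open>s\<^sub>n - x\<^sub>n\<close> that is measurable on the whole space. On paths unbounded to the left \<open>Max\<close>
is applied to an infinite set; its value there is a fixed number, so even then the result depends
only on the steps up to time \<open>n\<close>.\<close>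

definition queue_length :: "(int \<Rightarrow> int) \<Rightarrow> int \<Rightarrow> nat" where
  "queue_length \<omega> n = Max {i. \<exists>m\<le>n. walk \<omega> m - walk \<omega> n = int i}"

text \<open>Agrees with \<open>T\<close> on \<open>Omega1\<close>, and is measurable and maps into \<open>Omega\<close> without restriction.\<close>

definition departures :: "(int \<Rightarrow> int) \<Rightarrow> int \<Rightarrow> int" where
  "departures \<omega> n = (if \<omega> n = -1 \<or> queue_length \<omega> (n - 1) = 0 then 1 else -1)"

lemma walk_0 [simp]: "walk \<omega> 0 = 0"
  by (simp add: walk.simps)

lemma walk_step: "walk \<omega> n = walk \<omega> (n - 1) + \<omega> n"
proof (cases "n > 0")
  case True
  then show ?thesis by (subst walk.simps) simp
next
  case False
  then show ?thesis by (subst (2) walk.simps) simp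
qed

lemma walk_diff_cong:
  assumes "m \<le> n" and "\<And>i. i \<le> n \<Longrightarrow> \<omega> i = \<omega>' i"
  shows "walk \<omega> m - walk \<omega> n = walk \<omega>' m - walk \<omega>' n"
  using assms(1)
proof (induction m rule: int_le_induct)
  case (step i)
  then show ?case
    using walk_step[of \<omega> i] walk_step[of \<omega>' i] assms(2)[of i] by simp
qed simp

text \<open>The increments \<open>x\<^sub>m - x\<^sub>n\<close>, \<open>m \<le> n\<close>, see only the steps up to time \<open>n\<close>, although the walk itself
is normalised at time \<open>0\<close>.\<close>

lemma queue_length_cong:
  assumes "\<And>i. i \<le> n \<Longrightarrow> \<omega> i = \<omega>' i"
  shows "queue_length \<omega> n = queue_length \<omega>' n"
proof -
  have "(\<exists>m\<le>n. walk \<omega> m - walk \<omega> n = int i) \<longleftrightarrow> (\<exists>m\<le>n. walk \<omega>' m - walk \<omega>' n = int i)" for i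
    using walk_diff_cong[of _ n \<omega> \<omega>', OF _ assms] by auto
  then show ?thesis by (simp add: queue_length_def)
qed

lemma departures_cong:
  assumes "\<And>i. i \<le> n \<Longrightarrow> \<omega> i = \<omega>' i"
  shows "departures \<omega> n = departures \<omega>' n"
  using assms queue_length_cong[of "n - 1" \<omega> \<omega>'] by (simp add: departures_def)

lemma funpow_departures_cong:
  assumes "\<And>i. i \<le> n \<Longrightarrow> \<omega> i = \<omega>' i" and "m \<le> n"
  shows "(departures ^^ k) \<omega> m = (departures ^^ k) \<omega>' m"
  using assms(2)
proof (induction k arbitrary: m)
  case (Suc k)
  then show ?case by (auto intro!: departures_cong)
qed (simp add: assms(1))

lemma departures_in: "departures \<omega> n \<in> {-1, 1}"
  by (simp add: departures_def)

lemma departures_in_Omega: "departures \<omega> \<in> Omega"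
  using departures_in by (auto simp: Omega_def)

lemma Omega_cases: "\<omega> \<in> Omega \<Longrightarrow> \<omega> n = -1 \<or> \<omega> n = 1"
  by (auto simp: Omega_def PiE_def Pi_def)

lemma bdd_above_walk_atMost:
  assumes "\<omega> \<in> Omega1"
  shows "bdd_above (walk \<omega> ` {..n})"
proof -
  have "bdd_above (walk \<omega> ` ({..0} \<union> {0..n}))"
    using assms by (simp add: image_Un Omega1_def)
  then show ?thesis by (rule bdd_above_mono) auto
qed

lemma run_sup_eq_queue_length:
  assumes "\<omega> \<in> Omega1"
  shows "run_sup \<omega> n = walk \<omega> n + int (queue_length \<omega> n)"
proof -
  define S where "S = {i. \<exists>m\<le>n. walk \<omega> m - walk \<omega> n = int i}"
  obtain c where c: "\<And>m. m \<le> n \<Longrightarrow> walk \<omega> m \<le> c"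
    using bdd_above_walk_atMost[OF assms, of n] by (auto simp: bdd_above_def)
  have "S \<subseteq> {..nat (c - walk \<omega> n)}"
    using c by (fastforce simp: S_def)
  then have fin: "finite S" by (rule finite_subset) simp
  have ne: "0 \<in> S" by (auto simp: S_def)
  have attained: "queue_length \<omega> n \<in> S"
    unfolding queue_length_def S_def[symmetric] using fin ne by (intro Max_in) auto
  have le: "walk \<omega> m \<le> walk \<omega> n + int (queue_length \<omega> n)" if "m \<le> n" for m
  proof (cases "walk \<omega> m \<le> walk \<omega> n")
    case False
    then have "nat (walk \<omega> m - walk \<omega> n) \<in> S"
      using that by (auto simp: S_def)
    then have "nat (walk \<omega> m - walk \<omega> n) \<le> queue_length \<omega> n"
      unfolding queue_length_def S_def[symmetric] using fin by simp
    then show ?thesis by simp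
  qed simp
  obtain m where "m \<le> n" "walk \<omega> m = walk \<omega> n + int (queue_length \<omega> n)"
    using attained by (auto simp: S_def algebra_simps)
  then show ?thesis
    unfolding run_sup_def by (intro cSup_eq_maximum) (use le in \<open>force+\<close>)
qed

text \<open>Lindley's recursion, from \<open>s\<^sub>n = max s\<^bsub>n-1\<^esub> x\<^sub>n\<close>. Truncated subtraction is the wasted service of
an empty queue.\<close>

lemma queue_length_step:
  assumes "\<omega> \<in> Omega1"
  shows "queue_length \<omega> n =
    (if \<omega> n = -1 then queue_length \<omega> (n - 1) + 1 else queue_length \<omega> (n - 1) - 1)"
proof -
  have "{..n} = insert n {..n - 1}" by auto
  then have "run_sup \<omega> n = sup (walk \<omega> n) (run_sup \<omega> (n - 1))"
    unfolding run_sup_def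
    using bdd_above_walk_atMost[OF assms, of "n - 1"] by (simp add: cSup_insert)
  moreover have "\<omega> n = -1 \<or> \<omega> n = 1"
    using assms Omega_cases by (auto simp: Omega1_def)
  ultimately show ?thesis
    using walk_step[of \<omega> n] run_sup_eq_queue_length[OF assms, of n]
      run_sup_eq_queue_length[OF assms, of "n - 1"]
    by (auto simp: sup_max max_def split: if_splits)
qed

lemma pitman_eq_departures:
  assumes "\<omega> \<in> Omega1"
  shows "pitman \<omega> = departures \<omega>"
proof
  fix n
  have "\<omega> n = -1 \<or> \<omega> n = 1"
    using assms Omega_cases by (auto simp: Omega1_def)
  then show "pitman \<omega> n = departures \<omega> n"
    using walk_step[of \<omega> n] run_sup_eq_queue_length[OF assms, of n]
      run_sup_eq_queue_length[OF assms, of "n - 1"] queue_length_step[OF assms, of n]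
    by (auto simp: pitman_def reflected_def departures_def)
qed

lemma walk_time_rev: "walk (time_rev \<omega>) m = walk \<omega> (-1) - walk \<omega> (- m - 1)"
proof (induction m rule: int_induct[where k = 0])
  case (step1 i)
  then show ?case
    using walk_step[of "time_rev \<omega>" "i + 1"] walk_step[of \<omega> "- (i + 1)"]
      time_rev_def[of \<omega> "i + 1"]
    by simp
next
  case (step2 i)
  then show ?case
    using walk_step[of "time_rev \<omega>" i] walk_step[of \<omega> "- i"] time_rev_def[of \<omega> i]
    by (simp add: algebra_simps)
qed simp

lemma walk_pitman: "walk (pitman \<omega>) n = reflected \<omega> n - reflected \<omega> 0"
proof (induction n rule: int_induct[where k = 0])
  case (step1 i)
  then show ?case using walk_step[of "pitman \<omega>" "i + 1"] pitman_def[of \<omega> "i + 1"] by simp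
next
  case (step2 i)
  then show ?case using walk_step[of "pitman \<omega>" i] pitman_def[of \<omega> i] by simp
qed simp

text \<open>On the right half-line \<open>T \<omega>\<close> is bounded below, because \<open>2 s\<^sub>n - x\<^sub>n \<ge> s\<^sub>n \<ge> 0\<close> for \<open>n \<ge> 0\<close>. Hence
\<open>R T R\<close> is computed, on the range of \<open>T\<close>, by the departures of the reversed queue.\<close>

lemma time_rev_pitman_in_Omega1:
  assumes "\<omega> \<in> Omega1"
  shows "time_rev (pitman \<omega>) \<in> Omega1"
proof -
  have "pitman \<omega> \<in> Omega"
    using pitman_eq_departures[OF assms] departures_in_Omega by simp
  then have "time_rev (pitman \<omega>) \<in> Omega"
    by (auto simp: Omega_def time_rev_def PiE_def Pi_def)
  have nonneg: "0 \<le> reflected \<omega> n" if "0 \<le> n" for n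
  proof -
    have "walk \<omega> m \<le> run_sup \<omega> n" if "m \<le> n" for m
      unfolding run_sup_def using bdd_above_walk_atMost[OF assms, of n] that
      by (intro cSUP_upper) auto
    from this[of 0] this[of n] that show ?thesis by (simp add: reflected_def)
  qed
  have "walk (time_rev (pitman \<omega>)) m \<le> walk (pitman \<omega>) (-1) + reflected \<omega> 0 + 1" if "m \<le> 0" for m
  proof (cases "m = 0")
    case True
    then show ?thesis using nonneg[of 0] walk_step[of "pitman \<omega>" 0] Omega_cases[OF \<open>pitman \<omega> \<in> Omega\<close>, of 0]
      by auto
  next
    case False
    then have "0 \<le> - m - 1" using that by simp
    from nonneg[OF this] show ?thesis
      by (simp add: walk_time_rev walk_pitman)
  qed
  then show ?thesis
    using \<open>time_rev (pitman \<omega>) \<in> Omega\<close> by (auto simp: Omega1_def bdd_above_def)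
qed

lemma queue_length_shift: "queue_length (\<lambda>m. \<omega> (m + n)) 0 = queue_length \<omega> n"
proof -
  have walk: "walk (\<lambda>m. \<omega> (m + n)) m = walk \<omega> (m + n) - walk \<omega> n" for m
  proof (induction m rule: int_induct[where k = 0])
    case (step1 i)
    then show ?case
      using walk_step[of "\<lambda>m. \<omega> (m + n)" "i + 1"] walk_step[of \<omega> "i + 1 + n"] by simp
  next
    case (step2 i)
    then show ?case
      using walk_step[of "\<lambda>m. \<omega> (m + n)" i] walk_step[of \<omega> "i + n"]
      by (simp add: algebra_simps)
  qed simp
  have "(\<exists>m\<le>0. walk \<omega> (m + n) - walk \<omega> n = int i) \<longleftrightarrow> (\<exists>m\<le>n. walk \<omega> m - walk \<omega> n = int i)" for i
  proof
    assume "\<exists>m\<le>n. walk \<omega> m - walk \<omega> n = int i"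
    then obtain m where "m \<le> n" "walk \<omega> m - walk \<omega> n = int i" by blast
    then show "\<exists>m\<le>0. walk \<omega> (m + n) - walk \<omega> n = int i"
      by (intro exI[of _ "m - n"]) simp
  next
    assume "\<exists>m\<le>0. walk \<omega> (m + n) - walk \<omega> n = int i"
    then obtain m where "m \<le> 0" "walk \<omega> (m + n) - walk \<omega> n = int i" by blast
    then show "\<exists>m\<le>n. walk \<omega> m - walk \<omega> n = int i"
      by (intro exI[of _ "m + n"]) simp
  qed
  then show ?thesis by (simp add: queue_length_def walk)
qed

section \<open>Reconstruction of the steps from the queue lengths\<close>

definition first_zero_even :: "(nat \<Rightarrow> nat) \<Rightarrow> bool" where
  "first_zero_even f \<longleftrightarrow> (\<exists>i. even i \<and> f i = 0 \<and> (\<forall>j<i. f j \<noteq> 0))"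

text \<open>Walking along a sequence of signs that flips at every nonzero entry of \<open>f\<close>, the first zero of \<open>f\<close>
anchors the sign, and the parity of its position gives the sign at the start.\<close>

lemma alternating_sign_eq:
  fixes b :: "nat \<Rightarrow> int"
  assumes zero: "\<And>i. f i = 0 \<Longrightarrow> b i = 1"
    and flip: "\<And>i. f i \<noteq> 0 \<Longrightarrow> b i = - b (Suc i)"
    and ex: "\<exists>i. f i = (0::nat)"
  shows "b 0 = (if first_zero_even f then 1 else -1)"
proof -
  define i where "i = (LEAST i. f i = 0)"
  have i: "f i = 0" "\<And>j. j < i \<Longrightarrow> f j \<noteq> 0"
    using LeastI_ex[OF ex] not_less_Least unfolding i_def by auto
  have "b 0 = (-1) ^ j * b j" if "j \<le> i" for j
    using that
  proof (induction j)
    case (Suc j)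
    then show ?case using flip[of j] i(2)[of j] by simp
  qed simp
  from this[of i] have "b 0 = (-1) ^ i" using zero[OF i(1)] by simp
  moreover have "first_zero_even f \<longleftrightarrow> even i"
    unfolding first_zero_even_def using i by (metis linorder_neqE_nat)
  ultimately show ?thesis by simp
qed

text \<open>For lengths \<open>\<alpha>\<close> at time \<open>n\<close>, the steps of all queues at time \<open>n + 1\<close> (\<open>next_step\<close>, searching an
empty queue to the left) and at time \<open>n\<close> (\<open>last_step\<close>, searching to the right).\<close>

definition next_step :: "(int \<Rightarrow> nat) \<Rightarrow> int \<Rightarrow> int" where
  "next_step \<alpha> k = (if first_zero_even (\<lambda>i. \<alpha> (k - 1 - int i)) then 1 else -1)"

definition last_step :: "(int \<Rightarrow> nat) \<Rightarrow> int \<Rightarrow> int" where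
  "last_step \<alpha> k = (if first_zero_even (\<lambda>i. \<alpha> (k + int i)) then 1 else -1)"

definition next_lengths :: "(int \<Rightarrow> nat) \<Rightarrow> int \<Rightarrow> nat" where
  "next_lengths \<alpha> k = (if next_step \<alpha> k = -1 then \<alpha> k + 1 else \<alpha> k - 1)"

text \<open>A service at time \<open>n\<close> was wasted, leaving the length unchanged, iff the next queue received \<open>1\<close>.\<close>

definition previous_lengths :: "(int \<Rightarrow> nat) \<Rightarrow> int \<Rightarrow> nat" where
  "previous_lengths \<alpha> k =
    (if last_step \<alpha> k = -1 then \<alpha> k - 1 else if last_step \<alpha> (k + 1) = 1 then \<alpha> k else \<alpha> k + 1)"

text \<open>The lengths at time \<open>0\<close> are moved forwards to time \<open>n - 1\<close>, where they determine the next step, or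
backwards to time \<open>n\<close>, where they determine the last one.\<close>

definition decode :: "(int \<Rightarrow> nat) \<Rightarrow> int \<Rightarrow> int" where
  "decode \<alpha> n =
    (if n > 0 then next_step ((next_lengths ^^ nat (n - 1)) \<alpha>) 0
     else last_step ((previous_lengths ^^ nat (- n)) \<alpha>) 0)"

text \<open>The array \<open>a n k\<close> holds the step of queue \<open>k\<close> at time \<open>n\<close>, and \<open>q n k\<close> its length after that
time. Both directions of time run the same sign propagation: forwards from the left, backwards
from the right.\<close>

lemma decode_tandem:
  fixes a :: "int \<Rightarrow> int \<Rightarrow> int" and q :: "int \<Rightarrow> int \<Rightarrow> nat"
  assumes sign: "\<And>n k. a n k = -1 \<or> a n k = 1"
    and emit: "\<And>n k. a n (k + 1) = (if a n k = -1 \<or> q (n - 1) k = 0 then 1 else -1)"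
    and update: "\<And>n k. q n k = (if a n k = -1 then q (n - 1) k + 1 else q (n - 1) k - 1)"
    and zero_left: "\<And>n k. \<exists>i. q n (k - int i) = 0"
    and zero_right: "\<And>n k. \<exists>i. q n (k + int i) = 0"
  shows "decode (q 0) n = a n 0"
proof -
  have nxt: "next_step (q n) k = a (n + 1) k" for n k
  proof -
    have out: "a (n + 1) (k - int i) =
        (if a (n + 1) (k - 1 - int i) = -1 \<or> q n (k - 1 - int i) = 0 then 1 else -1)" for i
      using emit[of "n + 1" "k - 1 - int i"] by (simp add: algebra_simps)
    have "a (n + 1) (k - int 0) =
        (if first_zero_even (\<lambda>i. q n (k - 1 - int i)) then 1 else -1)"
    proof (rule alternating_sign_eq)
      fix i assume "q n (k - 1 - int i) \<noteq> 0"
      then show "a (n + 1) (k - int i) = - a (n + 1) (k - int (Suc i))"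
        using out[of i] sign[of "n + 1" "k - 1 - int i"] by (auto simp: algebra_simps)
    qed (use out zero_left[of n "k - 1"] in auto)
    then show ?thesis by (simp add: next_step_def)
  qed
  have lst: "last_step (q n) k = a n k" for n k
  proof -
    have "a n (k + int 0) = (if first_zero_even (\<lambda>i. q n (k + int i)) then 1 else -1)"
    proof (rule alternating_sign_eq)
      fix i assume "q n (k + int i) = 0"
      then show "a n (k + int i) = 1"
        using update[of n "k + int i"] sign[of n "k + int i"] by auto
    next
      fix i assume "q n (k + int i) \<noteq> 0"
      then show "a n (k + int i) = - a n (k + int (Suc i))"
        using update[of n "k + int i"] sign[of n "k + int i"] emit[of n "k + int i"]
        by (auto simp: algebra_simps)
    qed (rule zero_right)
    then show ?thesis by (simp add: last_step_def)
  qed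
  have "next_lengths (q n) = q (n + 1)" for n
    using update[of "n + 1"] by (simp add: next_lengths_def nxt fun_eq_iff)
  then have fwd: "(next_lengths ^^ j) (q 0) = q (int j)" for j
    by (induction j) (auto simp: add.commute)
  have "previous_lengths (q n) = q (n - 1)" for n
    unfolding previous_lengths_def lst fun_eq_iff
  proof
    fix k
    show "(if a n k = -1 then q n k - 1 else if a n (k + 1) = 1 then q n k else q n k + 1) =
        q (n - 1) k"
      using update[of n k] emit[of n k] sign[of n k] by auto
  qed
  then have bwd: "(previous_lengths ^^ j) (q 0) = q (- int j)" for j
  proof (induction j)
    case (Suc j)
    moreover have "- int (Suc j) = - int j - 1" by simp
    ultimately show ?case
      by (simp only: funpow.simps comp_apply \<open>\<And>n. previous_lengths (q n) = q (n - 1)\<close>)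
  qed simp
  show ?thesis
    by (auto simp: decode_def fwd bwd nxt lst)
qed

section \<open>Product measures on two-sided sequences\<close>

text \<open>For countably many values, every finite-dimensional event is a countable disjoint union of point
cylinders over a large window. Only windows beyond a threshold \<open>w\<close> matter, which lets an
application assume that a given time lies inside the window.\<close>

lemma product_measure_eqI_windows:
  fixes M :: "'a measure" and N1 N2 :: "(int \<Rightarrow> 'a) measure" and w :: nat
  assumes countable: "countable (space M)" and M: "sets M = Pow (space M)"
    and sets: "sets N1 = sets (\<Pi>\<^sub>M i\<in>UNIV. M)" "sets N2 = sets (\<Pi>\<^sub>M i\<in>UNIV. M)"
    and finite: "finite_measure N1"
    and eq: "\<And>a d. w \<le> a \<Longrightarrow> (\<And>i. d i \<in> space M) \<Longrightarrow>
      emeasure N1 {\<omega> \<in> space N1. \<forall>i\<in>{- int a..int a}. \<omega> i = d i} =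
      emeasure N2 {\<omega> \<in> space N2. \<forall>i\<in>{- int a..int a}. \<omega> i = d i}"
  shows "N1 = N2"
proof (rule measure_eqI_PiM_infinite[OF sets _ finite])
  fix A :: "int \<Rightarrow> 'a set" and J :: "int set"
  assume J: "finite J" "J \<subseteq> UNIV" and A: "\<And>i. i \<in> J \<Longrightarrow> A i \<in> sets M"
  have "finite ((\<lambda>i. nat \<bar>i\<bar>) ` J)" using J by simp
  then obtain c where "\<forall>x\<in>(\<lambda>i. nat \<bar>i\<bar>) ` J. x \<le> c"
    by (auto simp: finite_nat_set_iff_bounded_le)
  then have c: "\<bar>i\<bar> \<le> int c" if "i \<in> J" for i using that by auto
  define a where "a = max w c"
  define W where "W = {- int a..int a}"
  have JW: "J \<subseteq> W"
    using c by (fastforce simp: W_def a_def)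
  define D where "D = {d \<in> W \<rightarrow>\<^sub>E space M. \<forall>i\<in>J. d i \<in> A i}"
  define C where "C d = {\<omega> \<in> UNIV \<rightarrow>\<^sub>E space M. \<forall>i\<in>W. \<omega> i = d i}" for d
  have space: "space N1 = UNIV \<rightarrow>\<^sub>E space M" "space N2 = UNIV \<rightarrow>\<^sub>E space M"
    using sets_eq_imp_space_eq[OF sets(1)] sets_eq_imp_space_eq[OF sets(2)]
    by (simp_all add: space_PiM)
  have cylinder: "prod_emb UNIV (\<lambda>_. M) J (Pi\<^sub>E J A) = (\<Union>d\<in>D. C d)"
  proof (intro equalityI subsetI)
    fix \<omega> assume "\<omega> \<in> prod_emb UNIV (\<lambda>_. M) J (Pi\<^sub>E J A)"
    then have "restrict \<omega> W \<in> D" "\<omega> \<in> C (restrict \<omega> W)"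
      using JW by (auto simp: prod_emb_def D_def C_def PiE_iff subset_eq)
    then show "\<omega> \<in> (\<Union>d\<in>D. C d)" by blast
  next
    fix \<omega> assume "\<omega> \<in> (\<Union>d\<in>D. C d)"
    then obtain d where d: "d \<in> D" "\<omega> \<in> C d" by blast
    have "\<omega> i \<in> A i" if "i \<in> J" for i
      using d JW that by (auto simp: D_def C_def)
    then show "\<omega> \<in> prod_emb UNIV (\<lambda>_. M) J (Pi\<^sub>E J A)"
      using d(2) by (auto simp: prod_emb_def C_def PiE_iff)
  qed
  have "countable (W \<rightarrow>\<^sub>E space M)"
    using countable by (intro countable_PiE) (auto simp: W_def)
  then have cD: "countable D" by (rule countable_subset[rotated]) (auto simp: D_def)
  have disj: "disjoint_family_on C D"
    unfolding disjoint_family_on_def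
  proof (intro ballI impI)
    fix d d' assume "d \<in> D" "d' \<in> D" "d \<noteq> d'"
    then obtain i where "i \<in> W" "d i \<noteq> d' i"
      unfolding D_def by (metis (lifting) PiE_ext mem_Collect_eq)
    then show "C d \<inter> C d' = {}" by (auto simp: C_def)
  qed
  have C_sets: "C d \<in> sets (\<Pi>\<^sub>M i\<in>UNIV. M)" if "d \<in> D" for d
  proof -
    have "C d = (\<Inter>i\<in>W. (\<lambda>\<omega>. \<omega> i) -` {d i} \<inter> space (\<Pi>\<^sub>M i\<in>UNIV. M))"
      by (auto simp: C_def space_PiM W_def)
    moreover have "{d i} \<in> sets M" if "i \<in> W" for i
      using \<open>d \<in> D\<close> that by (auto simp: M D_def PiE_iff)
    ultimately show ?thesis
      by (auto intro!: sets.finite_INT measurable_sets[OF measurable_component_singleton] simp: W_def)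
  qed
  have C_eq: "emeasure N1 (C d) = emeasure N2 (C d)" if "d \<in> D" for d
  proof -
    define d' where "d' = (\<lambda>i. if i \<in> W then d i else d 0)"
    have "d' i \<in> space M" for i
      using that by (auto simp: d'_def D_def W_def PiE_iff)
    moreover have "C d = {\<omega> \<in> UNIV \<rightarrow>\<^sub>E space M. \<forall>i\<in>{- int a..int a}. \<omega> i = d' i}"
      by (auto simp: C_def W_def[symmetric] d'_def)
    ultimately show ?thesis
      using eq[of a d'] by (simp add: space a_def)
  qed
  show "emeasure N1 (prod_emb UNIV (\<lambda>_. M) J (Pi\<^sub>E J A)) =
      emeasure N2 (prod_emb UNIV (\<lambda>_. M) J (Pi\<^sub>E J A))"
    unfolding cylinder using C_sets cD disj sets C_eq
    by (simp add: emeasure_UN_countable cong: nn_integral_cong_simp)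
qed

lemma measurable_count_space_binary:
  fixes f :: "'a \<Rightarrow> 'b::countable"
  assumes "f \<in> M \<rightarrow>\<^sub>M count_space UNIV" "g \<in> M \<rightarrow>\<^sub>M count_space UNIV"
  shows "(\<lambda>x. h (f x) (g x)) \<in> M \<rightarrow>\<^sub>M count_space UNIV"
  by (rule measurable_compose_countable[OF measurable_compose[OF assms(2)] assms(1)]) simp

section \<open>The law of a single queue length\<close>

text \<open>Almost sure boundedness to the left is an assumption here; in the application it holds because a
subset of \<open>Omega1\<close> has full measure.\<close>

locale biased_walk =
  fixes p :: real
  assumes p_range: "1/2 < p" "p \<le> 1"
    and AE_Omega1: "AE \<omega> in mu p. \<omega> \<in> Omega1"
begin

lemma rho_range: "0 \<le> rho p" "rho p < 1" and p_rho: "p * rho p = 1 - p"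
  using p_range by (simp_all add: rho_def field_simps)

definition step_prob :: "int \<Rightarrow> real" where
  "step_prob e = (if e = 1 then p else 1 - p)"

definition length_prob :: "nat \<Rightarrow> real" where
  "length_prob q = (1 - rho p) * rho p ^ q"

lemma step_prob_nonneg: "0 \<le> step_prob e"
  using p_range by (simp add: step_prob_def)

lemma space_step_measure: "space (step_measure p) = {-1, 1}"
  by (simp add: step_measure_def space_point_measure)

lemma sets_step_measure: "sets (step_measure p) = Pow {-1, 1}"
  by (simp add: step_measure_def sets_point_measure)

lemma emeasure_step_measure: "e \<in> {-1, 1} \<Longrightarrow> emeasure (step_measure p) {e} = ennreal (step_prob e)"
  by (auto simp: step_measure_def emeasure_point_measure_finite step_prob_def)

lemma prob_space_step: "prob_space (step_measure p)"
  using p_range by (intro prob_space_step_measure) auto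

lemma prob_space_mu: "prob_space (mu p)"
  unfolding mu_def by (intro prob_space_PiM prob_space_step)

sublocale steps: product_prob_space "\<lambda>_::int. step_measure p" UNIV
  by (intro product_prob_spaceI prob_space_step)

sublocale mu: prob_space "mu p"
  by (rule prob_space_mu)

lemma measurable_coordinate [measurable]: "(\<lambda>\<omega>. \<omega> n) \<in> mu p \<rightarrow>\<^sub>M count_space UNIV"
proof (rule measurable_compose)
  show "(\<lambda>\<omega>. \<omega> n) \<in> mu p \<rightarrow>\<^sub>M step_measure p"
    by (simp add: mu_def)
  show "(\<lambda>x. x) \<in> step_measure p \<rightarrow>\<^sub>M count_space UNIV"
    by (auto simp: measurable_def sets_step_measure space_step_measure)
qed

lemma measurable_into_mu:
  assumes "\<And>n. (\<lambda>x. f x n) \<in> N \<rightarrow>\<^sub>M count_space UNIV"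
    and "\<And>x n. x \<in> space N \<Longrightarrow> f x n \<in> {-1, 1}"
  shows "f \<in> N \<rightarrow>\<^sub>M mu p"
  unfolding mu_def
proof (rule measurable_PiM_single')
  fix n
  have "(\<lambda>x. f x n) -` A \<inter> space N \<in> sets N" for A
    using measurable_sets[OF assms(1)[of n], of A] by simp
  then show "(\<lambda>x. f x n) \<in> N \<rightarrow>\<^sub>M step_measure p"
    using assms(2) by (auto simp: measurable_def space_step_measure)
qed (use assms(2) in \<open>auto simp: space_step_measure\<close>)

lemma measurable_walk [measurable]: "(\<lambda>\<omega>. walk \<omega> n) \<in> mu p \<rightarrow>\<^sub>M count_space UNIV"
proof (induction n rule: int_induct[where k = 0])
  case (step1 i)
  then show ?case
    using measurable_count_space_binary[OF step1(2) measurable_coordinate, of "(+)" "i + 1"]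
    by (simp add: walk_step[of _ "i + 1"])
next
  case (step2 i)
  have "walk \<omega> (i - 1) = walk \<omega> i - \<omega> i" for \<omega> :: "int \<Rightarrow> int"
    using walk_step[of \<omega> i] by simp
  then show ?case
    using measurable_count_space_binary[OF step2(2) measurable_coordinate, of "(-)" i] by simp
qed simp

lemma measurable_queue_length [measurable]:
  "(\<lambda>\<omega>. queue_length \<omega> n) \<in> mu p \<rightarrow>\<^sub>M count_space UNIV"
proof -
  have [measurable]: "Measurable.pred (mu p) (\<lambda>\<omega>. walk \<omega> m - walk \<omega> n = int i)" for m i
    by (rule measurable_count_space_binary[where h = "\<lambda>a b. a - b = int i"]) measurable
  show ?thesis
    unfolding queue_length_def by measurable
qed

lemma measurable_departures [measurable]: "departures \<in> mu p \<rightarrow>\<^sub>M mu p"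
  using departures_in by (intro measurable_into_mu) (auto simp: departures_def)

lemma measurable_time_rev [measurable]: "time_rev \<in> mu p \<rightarrow>\<^sub>M mu p"
  by (intro measurable_into_mu) (auto simp: time_rev_def space_mu dest: Omega_cases)

lemma prob_window:
  assumes "finite J" "\<And>i. d i \<in> {-1, 1}"
  shows "mu.prob {\<omega> \<in> Omega. \<forall>i\<in>J. \<omega> i = d i} = (\<Prod>i\<in>J. step_prob (d i))"
proof -
  have "emeasure (mu p) {\<omega> \<in> Omega. \<forall>i\<in>J. \<omega> i = d i} =
      (\<Prod>i\<in>J. emeasure (step_measure p) {d i})"
    using steps.emeasure_PiM_Collect[of J "\<lambda>i. {d i}"] assms
    by (simp add: mu_def[symmetric] space_mu sets_step_measure)
  also have "\<dots> = ennreal (\<Prod>i\<in>J. step_prob (d i))"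
    using assms by (simp add: emeasure_step_measure prod_ennreal step_prob_nonneg)
  finally show ?thesis
    by (simp add: mu.emeasure_eq_measure prod_nonneg step_prob_nonneg)
qed

text \<open>An event that depends on the coordinates in \<open>A\<close> only is the preimage, under restriction to \<open>A\<close>, of
an event in the smaller product: fill the missing coordinates with the constant step \<open>1\<close>. So
independence of the two restrictions applies.\<close>

lemma prob_Int_disjoint_coordinates:
  assumes E: "E \<in> sets (mu p)" and F: "F \<in> sets (mu p)" and AB: "A \<inter> B = {}"
    and EA: "\<And>\<omega> \<omega>'. \<omega> \<in> Omega \<Longrightarrow> \<omega>' \<in> Omega \<Longrightarrow> (\<And>i. i \<in> A \<Longrightarrow> \<omega> i = \<omega>' i) \<Longrightarrow>
      \<omega> \<in> E \<Longrightarrow> \<omega>' \<in> E"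
    and FB: "\<And>\<omega> \<omega>'. \<omega> \<in> Omega \<Longrightarrow> \<omega>' \<in> Omega \<Longrightarrow> (\<And>i. i \<in> B \<Longrightarrow> \<omega> i = \<omega>' i) \<Longrightarrow>
      \<omega> \<in> F \<Longrightarrow> \<omega>' \<in> F"
  shows "mu.prob (E \<inter> F) = mu.prob E * mu.prob F"
proof -
  let ?step = "\<lambda>_::int. step_measure p"
  define fill where "fill C \<omega> i = (if i \<in> C then \<omega> i else (1::int))" for C and \<omega> :: "int \<Rightarrow> int" and i
  have fill: "fill C \<in> PiM C ?step \<rightarrow>\<^sub>M mu p" for C
    unfolding mu_def
  proof (rule measurable_PiM_single')
    show "(\<lambda>\<omega>. fill C \<omega> i) \<in> PiM C ?step \<rightarrow>\<^sub>M step_measure p" for i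
      by (cases "i \<in> C") (simp_all add: fill_def space_step_measure)
  qed (auto simp: fill_def space_PiM space_step_measure PiE_iff)
  define cut where "cut C G = fill C -` G \<inter> space (PiM C ?step)" for C G
  have cut: "(\<lambda>\<omega>. restrict \<omega> C) -` cut C G \<inter> space (mu p) = G"
    if "G \<in> sets (mu p)" and local: "\<And>\<omega> \<omega>'. \<omega> \<in> Omega \<Longrightarrow> \<omega>' \<in> Omega \<Longrightarrow>
      (\<And>i. i \<in> C \<Longrightarrow> \<omega> i = \<omega>' i) \<Longrightarrow> \<omega> \<in> G \<Longrightarrow> \<omega>' \<in> G" for C G
  proof -
    have "fill C (restrict \<omega> C) \<in> G \<longleftrightarrow> \<omega> \<in> G" if "\<omega> \<in> Omega" for \<omega>
    proof -
      have "fill C (restrict \<omega> C) \<in> Omega"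
        using that by (auto simp: fill_def Omega_def PiE_iff)
      then show ?thesis
        using local[of \<omega> "fill C (restrict \<omega> C)"] local[of "fill C (restrict \<omega> C)" \<omega>] that
        by (auto simp: fill_def)
    qed
    moreover have "restrict \<omega> C \<in> space (PiM C ?step)" if "\<omega> \<in> Omega" for \<omega>
      using that by (auto simp: space_PiM space_step_measure Omega_def PiE_iff)
    moreover have "G \<subseteq> Omega" using sets.sets_into_space[OF that(1)] by (simp add: space_mu)
    ultimately show ?thesis by (auto simp: cut_def space_mu)
  qed
  have coord: "(\<lambda>\<omega>. \<omega> i) \<in> mu p \<rightarrow>\<^sub>M step_measure p" for i
    by (simp add: mu_def)
  have "mu.indep_vars ?step (\<lambda>i \<omega>. \<omega> i) UNIV"
  proof (subst mu.indep_vars_iff_distr_eq_PiM)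
    show "distr (mu p) (\<Pi>\<^sub>M i\<in>UNIV. step_measure p) (\<lambda>x. \<lambda>i\<in>UNIV. x i) =
        (\<Pi>\<^sub>M i\<in>UNIV. distr (mu p) (step_measure p) (\<lambda>\<omega>. \<omega> i))"
      using steps.PiM_component by (simp add: mu_def restrict_UNIV distr_id)
  qed (use coord in auto)
  then have "mu.indep_var (PiM A ?step) (\<lambda>\<omega>. restrict \<omega> A) (PiM B ?step) (\<lambda>\<omega>. restrict \<omega> B)"
    using mu.indep_var_restrict[of ?step "\<lambda>i \<omega>. \<omega> i" UNIV A B] AB by simp
  then have "mu.prob ((\<lambda>\<omega>. (restrict \<omega> A, restrict \<omega> B)) -` (cut A E \<times> cut B F) \<inter> space (mu p)) =
      mu.prob ((\<lambda>\<omega>. restrict \<omega> A) -` cut A E \<inter> space (mu p)) *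
      mu.prob ((\<lambda>\<omega>. restrict \<omega> B) -` cut B F \<inter> space (mu p))"
    by (rule mu.indep_varD) (auto simp: cut_def intro!: measurable_sets[OF fill] E F)
  moreover have "(\<lambda>\<omega>. (restrict \<omega> A, restrict \<omega> B)) -` (cut A E \<times> cut B F) \<inter> space (mu p) =
      ((\<lambda>\<omega>. restrict \<omega> A) -` cut A E \<inter> space (mu p)) \<inter>
      ((\<lambda>\<omega>. restrict \<omega> B) -` cut B F \<inter> space (mu p))"
    by auto
  ultimately show ?thesis
    by (simp add: cut[OF E EA] cut[OF F FB])
qed

lemma prob_queue_length_shift:
  "mu.prob {\<omega> \<in> Omega. queue_length \<omega> n = q} = mu.prob {\<omega> \<in> Omega. queue_length \<omega> 0 = q}"
proof -
  let ?shift = "\<lambda>(\<omega> :: int \<Rightarrow> int) m. \<omega> (m + n)"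
  have meas: "?shift \<in> mu p \<rightarrow>\<^sub>M mu p"
    by (intro measurable_into_mu) (auto simp: space_mu dest: Omega_cases)
  have "inj (\<lambda>m. m + n)" by (simp add: inj_def)
  then have "distr (mu p) (mu p) ?shift = mu p"
    using distr_PiM_reindex[of UNIV "\<lambda>_. step_measure p" "\<lambda>m. m + n" UNIV] prob_space_step
    by (simp add: mu_def restrict_UNIV)
  then have "mu.prob {\<omega> \<in> Omega. queue_length \<omega> 0 = q} =
      measure (distr (mu p) (mu p) ?shift) {\<omega> \<in> space (mu p). queue_length \<omega> 0 = q}"
    by (simp add: space_mu)
  also have "\<dots> = mu.prob (?shift -` {\<omega> \<in> space (mu p). queue_length \<omega> 0 = q} \<inter> space (mu p))"
    by (rule measure_distr[OF meas]) measurable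
  also have "?shift -` {\<omega> \<in> space (mu p). queue_length \<omega> 0 = q} \<inter> space (mu p) =
      {\<omega> \<in> Omega. queue_length \<omega> n = q}"
    using measurable_space[OF meas] by (auto simp: queue_length_shift space_mu)
  finally show ?thesis ..
qed

lemma prob_queue_length_window:
  assumes "\<And>i. d i \<in> {-1, 1}"
  shows "mu.prob {\<omega> \<in> Omega. queue_length \<omega> n = q \<and> (\<forall>i\<in>{n<..l}. \<omega> i = d i)} =
    mu.prob {\<omega> \<in> Omega. queue_length \<omega> n = q} * (\<Prod>i\<in>{n<..l}. step_prob (d i))"
proof -
  let ?E = "{\<omega> \<in> Omega. queue_length \<omega> n = q}" and ?F = "{\<omega> \<in> Omega. \<forall>i\<in>{n<..l}. \<omega> i = d i}"
  have "?E = {\<omega> \<in> space (mu p). queue_length \<omega> n = q}"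
    "?F = {\<omega> \<in> space (mu p). \<forall>i\<in>{n<..l}. \<omega> i = d i}"
    by (simp_all add: space_mu)
  then have sets: "?E \<in> sets (mu p)" "?F \<in> sets (mu p)"
    by (simp_all)
  have "mu.prob (?E \<inter> ?F) = mu.prob ?E * mu.prob ?F"
  proof (rule prob_Int_disjoint_coordinates[OF sets, of "{..n}" "{n<..l}"])
    fix \<omega> \<omega>' assume "\<omega>' \<in> Omega" "\<And>i. i \<in> {..n} \<Longrightarrow> \<omega> i = \<omega>' i" "\<omega> \<in> ?E"
    then show "\<omega>' \<in> ?E" using queue_length_cong[of n \<omega> \<omega>'] by auto
  qed auto
  moreover have "?E \<inter> ?F = {\<omega> \<in> Omega. queue_length \<omega> n = q \<and> (\<forall>i\<in>{n<..l}. \<omega> i = d i)}"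
    by auto
  ultimately show ?thesis using prob_window[of "{n<..l}" d] assms by simp
qed

text \<open>Stationarity and Lindley's recursion give \<open>f 0 = p f 0 + p f 1\<close> and
\<open>f (q + 1) = (1 - p) f q + p f (q + 2)\<close> for the law \<open>f\<close> of the length. The first equation starts,
and the second propagates, detailed balance \<open>p f (q + 1) = (1 - p) f q\<close>; so \<open>f\<close> is a multiple of
\<open>\<rho>\<^sup>q\<close>, and its total mass \<open>1\<close> fixes the factor.\<close>

lemma prob_queue_length: "mu.prob {\<omega> \<in> Omega. queue_length \<omega> n = q} = length_prob q"
proof -
  define f where "f q = mu.prob {\<omega> \<in> Omega. queue_length \<omega> 0 = q}" for q
  define J where "J q e = {\<omega> \<in> Omega. queue_length \<omega> 0 = q \<and> \<omega> 1 = e}" for q e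
  have f1: "mu.prob {\<omega> \<in> Omega. queue_length \<omega> 1 = q} = f q" for q
    unfolding f_def by (rule prob_queue_length_shift)
  have J_sets [measurable]: "J q e \<in> sets (mu p)" for q e
    by (simp add: J_def space_mu[of p, symmetric])
  have len_sets [measurable]: "{\<omega> \<in> Omega. queue_length \<omega> n = q} \<in> sets (mu p)" for n q
    by (simp add: space_mu[of p, symmetric])
  have prob_J: "mu.prob (J q e) = f q * step_prob e" if "e \<in> {-1, 1}" for q e
  proof -
    have "{0<..1} = {1::int}" by auto
    then show ?thesis
      using prob_queue_length_window[of "\<lambda>_. e" 0 q 1] that by (simp add: J_def f_def)
  qed
  have balance: "f q = mu.prob (J a e) + mu.prob (J b e')"
    if "(a, e) \<noteq> (b, e')"
      and *: "\<And>\<omega>. \<omega> \<in> Omega1 \<Longrightarrow> queue_length \<omega> 1 = q \<longleftrightarrow>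
        queue_length \<omega> 0 = a \<and> \<omega> 1 = e \<or> queue_length \<omega> 0 = b \<and> \<omega> 1 = e'" for q a b e e'
  proof -
    have "f q = mu.prob (J a e \<union> J b e')"
      unfolding f1[symmetric]
    proof (rule mu.finite_measure_eq_AE)
      show "AE \<omega> in mu p. \<omega> \<in> {\<omega> \<in> Omega. queue_length \<omega> 1 = q} \<longleftrightarrow> \<omega> \<in> J a e \<union> J b e'"
        using AE_Omega1
      proof eventually_elim
        case (elim \<omega>)
        then have "\<omega> \<in> Omega" by (simp add: Omega1_def)
        then show ?case using *[OF elim] by (auto simp: J_def)
      qed
    qed (use len_sets J_sets in blast)+
    also have "\<dots> = mu.prob (J a e) + mu.prob (J b e')"
    proof (rule mu.finite_measure_Union[OF J_sets J_sets])
      show "J a e \<inter> J b e' = {}" using that(1) by (auto simp: J_def)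
    qed
    finally show ?thesis .
  qed
  have step: "queue_length \<omega> 1 = (if \<omega> 1 = -1 then queue_length \<omega> 0 + 1 else queue_length \<omega> 0 - 1)"
    "\<omega> 1 = -1 \<or> \<omega> 1 = 1" if "\<omega> \<in> Omega1" for \<omega>
    using queue_length_step[OF that, of 1] Omega_cases[of \<omega> 1] that by (auto simp: Omega1_def)
  have "f 0 = mu.prob (J 0 1) + mu.prob (J 1 1)"
  proof (rule balance)
    fix \<omega> assume "\<omega> \<in> Omega1"
    from step[OF this] show "queue_length \<omega> 1 = 0 \<longleftrightarrow>
        queue_length \<omega> 0 = 0 \<and> \<omega> 1 = 1 \<or> queue_length \<omega> 0 = 1 \<and> \<omega> 1 = 1"
      by auto
  qed simp
  then have base: "p * f 1 = (1 - p) * f 0"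
    by (simp add: prob_J step_prob_def algebra_simps)
  have rec: "f (Suc q) = (1 - p) * f q + p * f (q + 2)" for q
  proof -
    have "f (Suc q) = mu.prob (J q (-1)) + mu.prob (J (q + 2) 1)"
    proof (rule balance)
      fix \<omega> assume "\<omega> \<in> Omega1"
      from step[OF this] show "queue_length \<omega> 1 = Suc q \<longleftrightarrow>
          queue_length \<omega> 0 = q \<and> \<omega> 1 = -1 \<or> queue_length \<omega> 0 = q + 2 \<and> \<omega> 1 = 1"
        by auto
    qed simp
    then show ?thesis by (simp add: prob_J step_prob_def)
  qed
  have detailed: "p * f (Suc q) = (1 - p) * f q" for q
  proof (induction q)
    case (Suc q)
    have "p * f (Suc (Suc q)) = f (Suc q) - (1 - p) * f q"
      using rec[of q] by simp
    also have "\<dots> = (1 - p) * f (Suc q)"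
      using Suc by (simp add: left_diff_distrib)
    finally show ?case .
  qed (use base in simp)
  have ratio: "f (Suc q) = rho p * f q" for q
    using detailed[of q] p_range by (simp add: rho_def field_simps)
  have f_pow: "f q = f 0 * rho p ^ q" for q
    by (induction q) (simp_all add: ratio)
  have "(\<lambda>q. f 0 * rho p ^ q) sums (f 0 * (1 / (1 - rho p)))"
    using rho_range by (intro sums_mult geometric_sums) auto
  then have "f sums (f 0 * (1 / (1 - rho p)))"
    by (simp add: f_pow[symmetric])
  moreover have "f sums 1"
  proof -
    have "(\<lambda>q. mu.prob {\<omega> \<in> Omega. queue_length \<omega> 0 = q}) sums
        mu.prob (\<Union>q. {\<omega> \<in> Omega. queue_length \<omega> 0 = q})"
      using len_sets by (intro mu.finite_measure_UNION) (auto simp: disjoint_family_on_def)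
    moreover have "(\<Union>q. {\<omega> \<in> Omega. queue_length \<omega> 0 = q}) = space (mu p)"
      by (auto simp: space_mu)
    ultimately show ?thesis by (simp add: f_def[abs_def] mu.prob_space)
  qed
  ultimately have "f 0 * (1 / (1 - rho p)) = 1"
    by (rule sums_unique2)
  then have "f 0 = 1 - rho p"
    using rho_range by (simp add: field_simps)
  then show ?thesis
    using prob_queue_length_shift[of n q] f_pow[of q] by (simp add: f_def length_prob_def)
qed


section \<open>Burke's theorem\<close>

text \<open>The departures up to time \<open>n\<close>, followed by the untouched arrivals. Keeping the future arrivals in
the sequence turns the induction over \<open>n\<close> into an exchange of the single coordinate \<open>n + 1\<close>, so that
independence of the future enters once, at its start.\<close>

definition partial_departures :: "int \<Rightarrow> (int \<Rightarrow> int) \<Rightarrow> int \<Rightarrow> int" where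
  "partial_departures n \<omega> m = (if m \<le> n then departures \<omega> m else \<omega> m)"

lemma measurable_departures_coordinate [measurable]:
  "(\<lambda>\<omega>. departures \<omega> i) \<in> mu p \<rightarrow>\<^sub>M count_space UNIV"
  by (rule measurable_compose[OF measurable_departures measurable_coordinate])

lemma measurable_partial_departures [measurable]: "partial_departures n \<in> mu p \<rightarrow>\<^sub>M mu p"
  by (intro measurable_into_mu)
    (auto simp: partial_departures_def space_mu departures_def dest: Omega_cases)

lemma measurable_partial_departures_coordinate [measurable]:
  "(\<lambda>\<omega>. partial_departures n \<omega> i) \<in> mu p \<rightarrow>\<^sub>M count_space UNIV"
  by (rule measurable_compose[OF measurable_partial_departures measurable_coordinate])

text \<open>In the step from \<open>n\<close> to \<open>n + 1\<close>, the pair (length after, output) at time \<open>n + 1\<close> comes from exactly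
one pair (length before, arrival step), namely \<open>(q, -1)\<close> from \<open>(q + 1, 1)\<close>, \<open>(q + 1, 1)\<close> from
\<open>(q, -1)\<close>, and \<open>(0, 1)\<close> from \<open>(0, 1)\<close>. The two pairs have equal weight because \<open>p \<rho> = 1 - p\<close>.\<close>

lemma prob_queue_length_partial_departures_window:
  assumes "k \<le> n" "n \<le> l" "\<And>i. d i \<in> {-1, 1}"
  shows "mu.prob {\<omega> \<in> Omega. queue_length \<omega> n = q \<and>
      (\<forall>i\<in>{k<..l}. partial_departures n \<omega> i = d i)} =
    length_prob q * (\<Prod>i\<in>{k<..l}. step_prob (d i))"
  using assms
proof (induction n arbitrary: q d rule: int_ge_induct)
  case base
  have "{\<omega> \<in> Omega. queue_length \<omega> k = q \<and> (\<forall>i\<in>{k<..l}. partial_departures k \<omega> i = d i)} =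
      {\<omega> \<in> Omega. queue_length \<omega> k = q \<and> (\<forall>i\<in>{k<..l}. \<omega> i = d i)}"
    by (auto simp: partial_departures_def)
  then show ?case
    using prob_queue_length_window[of d k q l] base by (simp add: prob_queue_length)
next
  case (step n)
  \<comment> \<open>the unique state and step that produce length \<open>q\<close> and output \<open>d (n + 1)\<close>\<close>
  define q0 e0 where "q0 = (if d (n + 1) = -1 then q + 1 else q - 1)"
    and "e0 = (if d (n + 1) = -1 \<or> q = 0 then 1 else -1 :: int)"
  define d0 where "d0 = d(n + 1 := e0)"
  have d: "d (n + 1) = -1 \<or> d (n + 1) = 1" using step.prems(2)[of "n + 1"] by simp
  have d0: "d0 i \<in> {-1, 1}" for i
    using step.prems(2)[of i] by (auto simp: d0_def e0_def)
  have mem: "n + 1 \<in> {k<..l}" using step by auto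
  have local: "queue_length \<omega> (n + 1) = q \<and> departures \<omega> (n + 1) = d (n + 1) \<longleftrightarrow>
      queue_length \<omega> n = q0 \<and> \<omega> (n + 1) = e0" if "\<omega> \<in> Omega1" for \<omega>
  proof -
    have "\<omega> (n + 1) = -1 \<or> \<omega> (n + 1) = 1"
      using that Omega_cases by (auto simp: Omega1_def)
    then show ?thesis
      using d queue_length_step[OF that, of "n + 1"]
      by (auto simp: departures_def q0_def e0_def split: if_splits)
  qed
  have split_window: "(\<forall>i\<in>{k<..l}. P i) \<longleftrightarrow> P (n + 1) \<and> (\<forall>i\<in>{k<..l} - {n + 1}. P i)" for P
    using mem by blast
  have rest: "(\<forall>i\<in>{k<..l} - {n + 1}. partial_departures (n + 1) \<omega> i = d i) \<longleftrightarrow>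
      (\<forall>i\<in>{k<..l} - {n + 1}. partial_departures n \<omega> i = d0 i)" for \<omega>
    by (rule ball_cong) (auto simp: partial_departures_def d0_def)
  have "mu.prob {\<omega> \<in> Omega. queue_length \<omega> (n + 1) = q \<and>
        (\<forall>i\<in>{k<..l}. partial_departures (n + 1) \<omega> i = d i)} =
      mu.prob {\<omega> \<in> Omega. queue_length \<omega> n = q0 \<and>
        (\<forall>i\<in>{k<..l}. partial_departures n \<omega> i = d0 i)}" (is "mu.prob ?A = mu.prob ?B")
  proof (rule mu.finite_measure_eq_AE)
    show "AE \<omega> in mu p. \<omega> \<in> ?A \<longleftrightarrow> \<omega> \<in> ?B"
      using AE_Omega1
    proof eventually_elim
      case (elim \<omega>)
      then show ?case
        unfolding mem_Collect_eq split_window rest using local[OF elim]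
        by (auto simp: partial_departures_def d0_def)
    qed
    show "?A \<in> sets (mu p)" "?B \<in> sets (mu p)"
      unfolding space_mu[of p, symmetric] by measurable
  qed
  also have "\<dots> = length_prob q0 * (\<Prod>i\<in>{k<..l}. step_prob (d0 i))"
    using step.IH[of d0 q0] step.prems d0 by simp
  also have "\<dots> = length_prob q0 * step_prob e0 * (\<Prod>i\<in>{k<..l} - {n + 1}. step_prob (d i))"
    using mem by (simp add: prod.remove[OF _ mem] d0_def)
  also have "length_prob q0 * step_prob e0 = length_prob q * step_prob (d (n + 1))"
    using d
    by (cases q) (auto simp: length_prob_def step_prob_def q0_def e0_def p_rho[symmetric])
  also have "\<dots> * (\<Prod>i\<in>{k<..l} - {n + 1}. step_prob (d i)) =
      length_prob q * (\<Prod>i\<in>{k<..l}. step_prob (d i))"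
    using mem by (simp add: prod.remove[OF _ mem])
  finally show ?case .
qed

text \<open>Both sides are finite measures in \<open>E\<close>, so agreement on all large windows around time \<open>n\<close> suffices.\<close>

lemma prob_queue_length_partial_departures:
  assumes E: "E \<in> sets (mu p)"
  shows "mu.prob {\<omega> \<in> Omega. queue_length \<omega> n = q \<and> partial_departures n \<omega> \<in> E} =
    length_prob q * mu.prob E"
proof -
  define A where "A = {\<omega> \<in> Omega. queue_length \<omega> n = q}"
  have A [measurable]: "A \<in> sets (mu p)"
    unfolding A_def space_mu[of p, symmetric] by measurable
  define N1 where "N1 = distr (restrict_space (mu p) A) (mu p) (partial_departures n)"
  define N2 where "N2 = scale_measure (ennreal (length_prob q)) (mu p)"
  have meas: "partial_departures n \<in> restrict_space (mu p) A \<rightarrow>\<^sub>M mu p"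
    by (intro measurable_restrict_space1 measurable_partial_departures)
  have N1: "emeasure N1 G = mu.prob {\<omega> \<in> Omega. queue_length \<omega> n = q \<and> partial_departures n \<omega> \<in> G}"
    if "G \<in> sets (mu p)" for G
  proof -
    have "emeasure N1 G = emeasure (mu p) (partial_departures n -` G \<inter> space (restrict_space (mu p) A))"
      using emeasure_distr[OF meas that] A
      by (simp add: N1_def emeasure_restrict_space space_restrict_space)
    also have "partial_departures n -` G \<inter> space (restrict_space (mu p) A) =
        {\<omega> \<in> Omega. queue_length \<omega> n = q \<and> partial_departures n \<omega> \<in> G}"
      by (auto simp: space_restrict_space A_def space_mu)
    finally show ?thesis by (simp add: mu.emeasure_eq_measure)
  qed
  have "N1 = N2"
  proof (rule product_measure_eqI_windows[where M = "step_measure p" and w = "nat \<bar>n\<bar>"])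
    show "finite_measure N1"
      unfolding N1_def using A
      by (intro finite_measure.finite_measure_distr[OF _ meas] finite_measure_restrict_space)
        (auto simp: mu.finite_measure_axioms)
  next
    fix a :: nat and d :: "int \<Rightarrow> int"
    assume a: "nat \<bar>n\<bar> \<le> a" and "\<And>i. d i \<in> space (step_measure p)"
    then have d: "d i \<in> {-1, 1}" for i by (simp add: space_step_measure)
    define G where "G = {\<omega> \<in> Omega. \<forall>i\<in>{- int a..int a}. \<omega> i = d i}"
    have G: "G \<in> sets (mu p)"
      unfolding G_def space_mu[of p, symmetric] by measurable
    have window: "{- int a..int a} = {- int a - 1<..int a}" by auto
    have "{\<omega> \<in> Omega. queue_length \<omega> n = q \<and> partial_departures n \<omega> \<in> G} =
        {\<omega> \<in> Omega. queue_length \<omega> n = q \<and>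
          (\<forall>i\<in>{- int a - 1<..int a}. partial_departures n \<omega> i = d i)}"
      using measurable_space[OF measurable_partial_departures]
      by (auto simp: G_def window space_mu)
    then have "emeasure N1 G = emeasure N2 G"
      using N1[OF G] prob_queue_length_partial_departures_window[of "- int a - 1" n "int a" d q]
        prob_window[of "{- int a..int a}" d] a d rho_range
      by (simp add: N2_def G_def window[symmetric] mu.emeasure_eq_measure ennreal_mult
          length_prob_def prod_nonneg step_prob_nonneg)
    then show "emeasure N1 {\<omega> \<in> space N1. \<forall>i\<in>{- int a..int a}. \<omega> i = d i} =
        emeasure N2 {\<omega> \<in> space N2. \<forall>i\<in>{- int a..int a}. \<omega> i = d i}"
      by (simp add: N1_def N2_def G_def space_mu space_scale_measure)
  qed (simp_all add: N1_def N2_def space_step_measure sets_step_measure mu_def)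
  then have "emeasure N1 E = ennreal (length_prob q * mu.prob E)"
    using rho_range by (simp add: N2_def mu.emeasure_eq_measure ennreal_mult length_prob_def)
  then show ?thesis
    using N1[OF E] rho_range by (simp add: length_prob_def)
qed

lemma distr_mu_partial_departures: "distr (mu p) (mu p) (partial_departures n) = mu p"
proof (rule measure_eqI)
  fix E assume "E \<in> sets (distr (mu p) (mu p) (partial_departures n))"
  then have E [measurable]: "E \<in> sets (mu p)" by simp
  let ?A = "\<lambda>q. {\<omega> \<in> Omega. queue_length \<omega> n = q \<and> partial_departures n \<omega> \<in> E}"
  have "?A q \<in> sets (mu p)" for q
    unfolding space_mu[of p, symmetric] by measurable
  then have "(\<lambda>q. mu.prob (?A q)) sums mu.prob (\<Union>q. ?A q)"
    by (intro mu.finite_measure_UNION) (auto simp: disjoint_family_on_def)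
  moreover have "(\<Union>q. ?A q) = partial_departures n -` E \<inter> space (mu p)"
    by (auto simp: space_mu)
  moreover have "(\<lambda>q. length_prob q * mu.prob E) sums ((1 - rho p) * (1 / (1 - rho p)) * mu.prob E)"
    unfolding length_prob_def using rho_range
    by (intro sums_mult sums_mult2 geometric_sums) auto
  ultimately have "mu.prob (partial_departures n -` E \<inter> space (mu p)) = mu.prob E"
    using rho_range
    by (simp add: prob_queue_length_partial_departures[OF E]) (metis sums_unique2)
  then show "emeasure (distr (mu p) (mu p) (partial_departures n)) E = emeasure (mu p) E"
    by (simp add: emeasure_distr mu.emeasure_eq_measure)
qed simp

text \<open>A window is insensitive to the times after it, so the partial transformations decide.\<close>

lemma distr_mu_departures: "distr (mu p) (mu p) departures = mu p"
proof (rule product_measure_eqI_windows[where M = "step_measure p" and w = 0])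
  fix a :: nat and d :: "int \<Rightarrow> int"
  let ?G = "{\<omega> \<in> space (mu p). \<forall>i\<in>{- int a..int a}. \<omega> i = d i}"
  have "emeasure (mu p) (departures -` ?G \<inter> space (mu p)) =
      emeasure (mu p) (partial_departures (int a) -` ?G \<inter> space (mu p))"
    using measurable_space[OF measurable_partial_departures]
      measurable_space[OF measurable_departures]
    by (intro arg_cong[where f = "emeasure (mu p)"]) (auto simp: partial_departures_def)
  also have "\<dots> = emeasure (distr (mu p) (mu p) (partial_departures (int a))) ?G"
    by (rule emeasure_distr[symmetric]) measurable
  finally show "emeasure (distr (mu p) (mu p) departures)
        {\<omega> \<in> space (distr (mu p) (mu p) departures). \<forall>i\<in>{- int a..int a}. \<omega> i = d i} =
      emeasure (mu p) ?G"
    by (simp add: distr_mu_partial_departures emeasure_distr)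
next
  show "finite_measure (distr (mu p) (mu p) departures)"
    by (rule mu.finite_measure_distr) measurable
qed (simp_all add: space_step_measure sets_step_measure mu_def)

lemma measurable_funpow_departures [measurable]: "departures ^^ k \<in> mu p \<rightarrow>\<^sub>M mu p"
  by (induction k) (auto intro: measurable_comp)

text \<open>The lengths of the queues \<open>1, 2, ...\<close> at time \<open>n\<close> are those of a tandem
fed by the departures of queue \<open>0\<close> up to time \<open>n\<close>, which are i.i.d. steps independent of the
length of queue \<open>0\<close>.\<close>

lemma prob_tandem_queue_lengths:
  "mu.prob {\<omega> \<in> Omega. \<forall>i<N. queue_length ((departures ^^ i) \<omega>) n = c i} =
    (\<Prod>i<N. length_prob (c i))"
proof (induction N arbitrary: c)
  case 0
  then show ?case using mu.prob_space by (simp add: space_mu)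
next
  case (Suc N)
  define E where "E = {\<omega> \<in> Omega. \<forall>i<N. queue_length ((departures ^^ i) \<omega>) n = c (Suc i)}"
  have E: "E \<in> sets (mu p)"
    unfolding E_def space_mu[of p, symmetric] by measurable
  have "queue_length ((departures ^^ i) (departures \<omega>)) n =
      queue_length ((departures ^^ i) (partial_departures n \<omega>)) n" for i \<omega>
    by (intro queue_length_cong funpow_departures_cong[of n]) (auto simp: partial_departures_def)
  then have "{\<omega> \<in> Omega. \<forall>i<Suc N. queue_length ((departures ^^ i) \<omega>) n = c i} =
      {\<omega> \<in> Omega. queue_length \<omega> n = c 0 \<and> partial_departures n \<omega> \<in> E}"
    using measurable_space[OF measurable_partial_departures]
    by (auto simp: All_less_Suc2 E_def space_mu funpow_Suc_right simp del: funpow.simps(2))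
  then have "mu.prob {\<omega> \<in> Omega. \<forall>i<Suc N. queue_length ((departures ^^ i) \<omega>) n = c i} =
      length_prob (c 0) * mu.prob E"
    by (simp only: prob_queue_length_partial_departures[OF E])
  also have "mu.prob E = (\<Prod>i<N. length_prob (c (Suc i)))"
    unfolding E_def by (rule Suc)
  finally show ?case by (simp only: prod.lessThan_Suc_shift)
qed


section \<open>Two-sided tandems\<close>

lemma distr_mu_time_rev: "distr (mu p) (mu p) time_rev = mu p"
proof -
  have "inj (uminus :: int \<Rightarrow> int)" by simp
  then show ?thesis
    using distr_PiM_reindex[of UNIV "\<lambda>_. step_measure p" "uminus :: int \<Rightarrow> int" UNIV] prob_space_step
    by (simp add: mu_def restrict_UNIV time_rev_def[abs_def])
qed

definition reversed_departures :: "(int \<Rightarrow> int) \<Rightarrow> int \<Rightarrow> int" where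
  "reversed_departures = time_rev \<circ> departures \<circ> time_rev"

text \<open>The measurable counterpart of \<open>pitman_pow\<close>, defined and \<open>\<mu>\<close>-preserving on the whole space.\<close>

definition tandem :: "int \<Rightarrow> (int \<Rightarrow> int) \<Rightarrow> int \<Rightarrow> int" where
  "tandem k = (if k \<ge> 0 then departures ^^ nat k else reversed_departures ^^ nat (- k))"

definition tandem_lengths :: "int \<Rightarrow> (int \<Rightarrow> int) \<Rightarrow> int \<Rightarrow> nat" where
  "tandem_lengths n \<omega> k = queue_length (tandem k \<omega>) n"

lemma distr_mu_compose:
  assumes "f \<in> mu p \<rightarrow>\<^sub>M mu p" "g \<in> mu p \<rightarrow>\<^sub>M mu p"
    and "distr (mu p) (mu p) f = mu p" "distr (mu p) (mu p) g = mu p"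
  shows "distr (mu p) (mu p) (f \<circ> g) = mu p"
  using distr_distr[OF assms(1,2)] assms(3,4) by simp

lemma distr_mu_funpow:
  assumes "f \<in> mu p \<rightarrow>\<^sub>M mu p" "distr (mu p) (mu p) f = mu p"
  shows "f ^^ k \<in> mu p \<rightarrow>\<^sub>M mu p \<and> distr (mu p) (mu p) (f ^^ k) = mu p"
proof (induction k)
  case 0
  then show ?case by (simp add: distr_id id_def)
next
  case (Suc k)
  then show ?case
    unfolding funpow.simps
    using assms distr_mu_compose[of f "f ^^ k"] measurable_comp[of "f ^^ k" "mu p" "mu p" f "mu p"]
    by blast
qed

lemma measurable_tandem [measurable]: "tandem k \<in> mu p \<rightarrow>\<^sub>M mu p"
  and distr_mu_tandem: "distr (mu p) (mu p) (tandem k) = mu p"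
proof -
  have "reversed_departures \<in> mu p \<rightarrow>\<^sub>M mu p \<and> distr (mu p) (mu p) reversed_departures = mu p"
    unfolding reversed_departures_def
    using measurable_comp[OF measurable_time_rev measurable_departures]
      measurable_comp[OF measurable_comp[OF measurable_time_rev measurable_departures] measurable_time_rev]
    by (auto simp: comp_assoc intro!: distr_mu_compose measurable_time_rev measurable_departures
        distr_mu_departures distr_mu_time_rev)
  then have "tandem k \<in> mu p \<rightarrow>\<^sub>M mu p \<and> distr (mu p) (mu p) (tandem k) = mu p"
    unfolding tandem_def
    using distr_mu_funpow distr_mu_departures measurable_departures by auto
  then show "tandem k \<in> mu p \<rightarrow>\<^sub>M mu p" "distr (mu p) (mu p) (tandem k) = mu p"
    by auto
qed

lemma space_gamma: "space (gamma p) = UNIV"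
  by (simp add: gamma_def space_PiM)

lemma sets_gamma: "sets (gamma p) = sets (\<Pi>\<^sub>M k\<in>UNIV. count_space UNIV)"
  unfolding gamma_def by (intro sets_PiM_cong) auto

sublocale lengths: product_prob_space "\<lambda>_::int. measure_pmf (geometric_pmf (1 - rho p))" UNIV
  by (intro product_prob_spaceI prob_space_measure_pmf)

sublocale gamma: prob_space "gamma p"
  unfolding gamma_def by (rule lengths.prob_space_axioms)

lemma measurable_gamma_coordinate [measurable]: "(\<lambda>\<alpha>. \<alpha> k) \<in> gamma p \<rightarrow>\<^sub>M count_space UNIV"
  unfolding measurable_cong_sets[OF sets_gamma refl] by simp

lemma measurable_into_gamma:
  "(\<And>k. (\<lambda>x. f x k) \<in> N \<rightarrow>\<^sub>M count_space UNIV) \<Longrightarrow> f \<in> N \<rightarrow>\<^sub>M gamma p"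
  unfolding measurable_cong_sets[OF refl sets_gamma] by (rule measurable_PiM_single') auto

lemma measurable_tandem_lengths [measurable]: "tandem_lengths n \<in> mu p \<rightarrow>\<^sub>M gamma p"
  by (intro measurable_into_gamma)
    (auto simp: tandem_lengths_def intro: measurable_compose[OF measurable_tandem measurable_queue_length])

lemma emeasure_geometric: "emeasure (measure_pmf (geometric_pmf (1 - rho p))) {q} = ennreal (length_prob q)"
  by (simp add: emeasure_pmf_single pmf_geometric_rho[OF p_range] length_prob_def)

lemma length_prob_nonneg: "0 \<le> length_prob q"
  using rho_range by (simp add: length_prob_def)

text \<open>Along any injective sequence of indices, \<open>N\<close> nonzero coordinates have probability \<open>\<rho>\<^sup>N\<close>.\<close>

lemma AE_gamma_ex_zero:
  fixes g :: "nat \<Rightarrow> int"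
  assumes "inj g"
  shows "AE \<alpha> in gamma p. \<exists>i. \<alpha> (g i) = 0"
proof -
  define Z where "Z = {\<alpha>. \<forall>i. \<alpha> (g i) \<noteq> (0::nat)}"
  have "Z = {\<alpha> \<in> space (gamma p). \<forall>i. \<alpha> (g i) \<noteq> 0}" by (simp add: Z_def space_gamma)
  then have Z: "Z \<in> sets (gamma p)" by simp
  have "gamma.prob Z \<le> rho p ^ N" for N
  proof -
    have "emeasure (gamma p) {\<alpha> \<in> space (gamma p). \<forall>k\<in>g ` {..<N}. \<alpha> k \<in> - {0}} =
        (\<Prod>k\<in>g ` {..<N}. emeasure (measure_pmf (geometric_pmf (1 - rho p))) (- {0}))"
      unfolding gamma_def by (rule lengths.emeasure_PiM_Collect) auto
    also have "emeasure (measure_pmf (geometric_pmf (1 - rho p))) (- {0}) = ennreal (rho p)"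
    proof -
      have "measure_pmf.prob (geometric_pmf (1 - rho p)) (- {0}) =
          1 - measure_pmf.prob (geometric_pmf (1 - rho p)) {0}"
        using measure_pmf.prob_compl[of "{0}" "geometric_pmf (1 - rho p)"]
        by (simp add: Compl_eq_Diff_UNIV)
      then show ?thesis
        by (simp add: measure_pmf.emeasure_eq_measure measure_pmf_single
            pmf_geometric_rho[OF p_range])
    qed
    also have "(\<Prod>k\<in>g ` {..<N}. ennreal (rho p)) = ennreal (rho p ^ N)"
      using assms rho_range by (simp add: card_image inj_on_def inj_def ennreal_power)
    finally have "gamma.prob {\<alpha> \<in> space (gamma p). \<forall>k\<in>g ` {..<N}. \<alpha> k \<in> - {0}} = rho p ^ N"
      using rho_range by (simp add: gamma.emeasure_eq_measure)
    moreover have "gamma.prob Z \<le> gamma.prob {\<alpha> \<in> space (gamma p). \<forall>k\<in>g ` {..<N}. \<alpha> k \<in> - {0}}"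
    proof (rule gamma.finite_measure_mono)
      have [measurable]: "Measurable.pred (gamma p) (\<lambda>\<alpha>. \<alpha> k \<in> - {0})" for k
        by (rule measurable_compose[OF measurable_gamma_coordinate]) simp
      show "{\<alpha> \<in> space (gamma p). \<forall>k\<in>g ` {..<N}. \<alpha> k \<in> - {0}} \<in> gamma.events"
        by measurable
    qed (auto simp: Z_def space_gamma)
    ultimately show ?thesis by simp
  qed
  moreover have "(\<lambda>N. rho p ^ N) \<longlonglongrightarrow> 0"
    using rho_range by (intro LIMSEQ_realpow_zero) auto
  ultimately have "gamma.prob Z \<le> 0"
    by (intro LIMSEQ_le_const) auto
  then have "gamma.prob Z = 0" using measure_nonneg[of "gamma p" Z] by linarith
  then have "emeasure (gamma p) Z = 0" by (simp add: gamma.emeasure_eq_measure)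
  then show ?thesis
    using Z by (intro AE_I[where N = Z]) (auto simp: Z_def)
qed

lemma AE_gamma_zeros:
  "AE \<alpha> in gamma p. \<forall>k. (\<exists>i. \<alpha> (k - int i) = 0) \<and> (\<exists>i. \<alpha> (k + int i) = 0)"
proof -
  have "AE \<alpha> in gamma p. (\<exists>i. \<alpha> (k - int i) = 0) \<and> (\<exists>i. \<alpha> (k + int i) = 0)" for k
    using AE_gamma_ex_zero[of "\<lambda>i. k - int i"] AE_gamma_ex_zero[of "\<lambda>i. k + int i"]
    by (auto simp: inj_def)
  then show ?thesis by (simp add: AE_all_countable)
qed

lemma measurable_decode [measurable]: "decode \<in> gamma p \<rightarrow>\<^sub>M mu p"
proof -
  have next_step [measurable]: "(\<lambda>\<alpha>. next_step (f \<alpha>) k) \<in> gamma p \<rightarrow>\<^sub>M count_space UNIV"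
    and last_step [measurable]: "(\<lambda>\<alpha>. last_step (f \<alpha>) k) \<in> gamma p \<rightarrow>\<^sub>M count_space UNIV"
    if [measurable]: "\<And>k. (\<lambda>\<alpha>. f \<alpha> k) \<in> gamma p \<rightarrow>\<^sub>M count_space UNIV" for f k
    unfolding next_step_def last_step_def first_zero_even_def by measurable
  have next_lengths: "(\<lambda>\<alpha>. next_lengths (f \<alpha>) k) \<in> gamma p \<rightarrow>\<^sub>M count_space UNIV"
    and previous_lengths: "(\<lambda>\<alpha>. previous_lengths (f \<alpha>) k) \<in> gamma p \<rightarrow>\<^sub>M count_space UNIV"
    if f [measurable]: "\<And>k. (\<lambda>\<alpha>. f \<alpha> k) \<in> gamma p \<rightarrow>\<^sub>M count_space UNIV" for f k
  proof -
    have [measurable]: "(\<lambda>\<alpha>. f \<alpha> k + 1) \<in> gamma p \<rightarrow>\<^sub>M count_space UNIV"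
      "(\<lambda>\<alpha>. f \<alpha> k - 1) \<in> gamma p \<rightarrow>\<^sub>M count_space UNIV" for k
      by (rule measurable_compose[OF f], simp)+
    have [measurable]: "Measurable.pred (gamma p) (\<lambda>\<alpha>. next_step (f \<alpha>) k = e)"
      "Measurable.pred (gamma p) (\<lambda>\<alpha>. last_step (f \<alpha>) k = e)" for k e
      by (rule measurable_compose[OF next_step[OF f]] measurable_compose[OF last_step[OF f]], simp)+
    show "(\<lambda>\<alpha>. next_lengths (f \<alpha>) k) \<in> gamma p \<rightarrow>\<^sub>M count_space UNIV"
      "(\<lambda>\<alpha>. previous_lengths (f \<alpha>) k) \<in> gamma p \<rightarrow>\<^sub>M count_space UNIV"
      unfolding next_lengths_def previous_lengths_def by measurable
  qed
  have nxt: "(\<lambda>\<alpha>. (next_lengths ^^ j) \<alpha> k) \<in> gamma p \<rightarrow>\<^sub>M count_space UNIV" for j k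
  proof (induction j arbitrary: k)
    case (Suc j)
    show ?case unfolding funpow.simps comp_apply by (rule next_lengths[OF Suc])
  qed simp
  have prv: "(\<lambda>\<alpha>. (previous_lengths ^^ j) \<alpha> k) \<in> gamma p \<rightarrow>\<^sub>M count_space UNIV" for j k
  proof (induction j arbitrary: k)
    case (Suc j)
    show ?case unfolding funpow.simps comp_apply by (rule previous_lengths[OF Suc])
  qed simp
  show ?thesis
  proof (rule measurable_into_mu)
    show "(\<lambda>\<alpha>. decode \<alpha> n) \<in> gamma p \<rightarrow>\<^sub>M count_space UNIV" for n
      unfolding decode_def using next_step[OF nxt] last_step[OF prv] by simp
  qed (auto simp: decode_def next_step_def last_step_def)
qed

end

section \<open>Queue lengths on an invariant set of full measure\<close>

locale pitman_system = biased_walk +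
  fixes Omega_star :: "(int \<Rightarrow> int) set"
  assumes star_sets [measurable]: "Omega_star \<in> sets (mu p)"
    and star_Omega1: "Omega_star \<subseteq> Omega1"
    and AE_star: "AE \<omega> in mu p. \<omega> \<in> Omega_star"
    and pitman_bij: "bij_betw pitman Omega_star Omega_star"
    and pitman_inv_pitman: "\<And>\<omega>. \<omega> \<in> Omega_star \<Longrightarrow> pitman_inv (pitman \<omega>) = \<omega>"
begin

lemma pitman_in_star: "\<omega> \<in> Omega_star \<Longrightarrow> pitman \<omega> \<in> Omega_star"
  using pitman_bij by (auto simp: bij_betw_def)

lemma pitman_eq: "\<omega> \<in> Omega_star \<Longrightarrow> pitman \<omega> = departures \<omega>"
  using star_Omega1 pitman_eq_departures by auto

lemma pitman_inv_in_star: "\<omega> \<in> Omega_star \<Longrightarrow> pitman_inv \<omega> \<in> Omega_star"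
  and pitman_pitman_inv: "\<omega> \<in> Omega_star \<Longrightarrow> pitman (pitman_inv \<omega>) = \<omega>"
  and pitman_inv_eq: "\<omega> \<in> Omega_star \<Longrightarrow> pitman_inv \<omega> = reversed_departures \<omega>"
proof -
  assume "\<omega> \<in> Omega_star"
  then obtain \<eta> where \<eta>: "\<eta> \<in> Omega_star" "\<omega> = pitman \<eta>"
    using pitman_bij by (auto simp: bij_betw_def)
  then show "pitman_inv \<omega> \<in> Omega_star" "pitman (pitman_inv \<omega>) = \<omega>"
    by (simp_all add: pitman_inv_pitman)
  have "time_rev \<omega> \<in> Omega1"
    using \<eta> star_Omega1 time_rev_pitman_in_Omega1 by auto
  then show "pitman_inv \<omega> = reversed_departures \<omega>"
    by (simp add: pitman_inv_def reversed_departures_def pitman_eq_departures)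
qed

lemma pitman_pow:
  assumes "\<omega> \<in> Omega_star"
  shows "pitman_pow k \<omega> \<in> Omega_star" "pitman_pow k \<omega> = tandem k \<omega>"
proof -
  have P: "(pitman ^^ j) \<omega> \<in> Omega_star \<and> (pitman ^^ j) \<omega> = (departures ^^ j) \<omega>" for j
    by (induction j) (use assms pitman_in_star pitman_eq in auto)
  have N: "(pitman_inv ^^ j) \<omega> \<in> Omega_star \<and>
      (pitman_inv ^^ j) \<omega> = (reversed_departures ^^ j) \<omega>" for j
    by (induction j) (use assms pitman_inv_in_star pitman_inv_eq in auto)
  have "pitman_pow k \<omega> \<in> Omega_star \<and> pitman_pow k \<omega> = tandem k \<omega>"
  proof (cases "k \<ge> 0")
    case True
    show ?thesis unfolding pitman_pow_def tandem_def if_P[OF True] by (rule P)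
  next
    case False
    show ?thesis unfolding pitman_pow_def tandem_def if_not_P[OF False] by (rule N)
  qed
  then show "pitman_pow k \<omega> \<in> Omega_star" "pitman_pow k \<omega> = tandem k \<omega>"
    by blast+
qed

lemma pitman_pow_add_1:
  assumes "\<omega> \<in> Omega_star"
  shows "pitman_pow (k + 1) \<omega> = pitman (pitman_pow k \<omega>)"
    and "pitman_pow (k + 1) \<omega> = pitman_pow k (pitman \<omega>)"
proof -
  have "pitman_pow (k + 1) \<omega> = pitman (pitman_pow k \<omega>) \<and>
      pitman_pow (k + 1) \<omega> = pitman_pow k (pitman \<omega>)"
  proof (cases "k \<ge> 0")
    case True
    then have "nat (k + 1) = Suc (nat k)" by simp
    then show ?thesis
      using True by (simp add: pitman_pow_def) (simp flip: funpow_swap1)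
  next
    case False
    define j where "j = nat (- k - 1)"
    have k: "nat (- k) = Suc j" "k + 1 = - int j" using False by (auto simp: j_def)
    have "pitman_pow (- int j) \<omega> = (pitman_inv ^^ j) \<omega>"
      by (cases j) (simp_all add: pitman_pow_def nat_add_distrib)
    moreover have "pitman_pow (- int j) \<omega> \<in> Omega_star" using pitman_pow[OF assms] by simp
    ultimately show ?thesis
      using False assms
      by (simp add: k pitman_pow_def pitman_pitman_inv)
         (simp add: funpow_swap1 pitman_inv_pitman)
  qed
  then show "pitman_pow (k + 1) \<omega> = pitman (pitman_pow k \<omega>)"
    and "pitman_pow (k + 1) \<omega> = pitman_pow k (pitman \<omega>)"
    by auto
qed

lemma tandem_add_1:
  "\<omega> \<in> Omega_star \<Longrightarrow> tandem (k + 1) \<omega> = departures (tandem k \<omega>)"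
  using pitman_pow_add_1(1)[of \<omega> k] pitman_pow[of \<omega>] pitman_eq by metis

lemma tandem_add_nat:
  assumes "\<omega> \<in> Omega_star"
  shows "tandem (k + int i) \<omega> = (departures ^^ i) (tandem k \<omega>)"
proof (induction i)
  case (Suc i)
  have "k + int (Suc i) = (k + int i) + 1" by simp
  then show ?case using Suc by (simp only: tandem_add_1[OF assms] funpow.simps comp_apply)
qed simp

lemma phi_eq:
  assumes "\<omega> \<in> Omega_star"
  shows "phi \<omega> = tandem_lengths 0 \<omega>"
proof
  fix k
  have "tandem k \<omega> \<in> Omega1"
    using pitman_pow[OF assms, of k] star_Omega1 by auto
  then show "phi \<omega> k = tandem_lengths 0 \<omega> k"
    using run_sup_eq_queue_length[of "tandem k \<omega>" 0]
    by (simp add: phi_def tandem_lengths_def pitman_pow(2)[OF assms])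
qed

lemma theta_phi:
  assumes "\<omega> \<in> Omega_star"
  shows "theta (phi \<omega>) = phi (pitman \<omega>)"
  by (rule ext) (simp add: theta_def phi_def pitman_pow_add_1(2)[OF assms])

text \<open>On the window \<open>{-a..a}\<close> the lengths of \<open>\<omega>\<close> are those of a one-sided tandem started from \<open>T\<^bsup>-a\<^esup> \<omega>\<close>,
whose law is again \<open>\<mu>\<close>.\<close>

lemma distr_mu_tandem_lengths: "distr (mu p) (gamma p) (tandem_lengths n) = gamma p"
proof (rule product_measure_eqI_windows
    [where M = "measure_pmf (geometric_pmf (1 - rho p))" and w = 0])
  fix a :: nat and c :: "int \<Rightarrow> nat"
  let ?W = "{- int a..int a}"
  let ?G = "{\<alpha> \<in> space (gamma p). \<forall>k\<in>?W. \<alpha> k = c k}"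
  define N where "N = 2 * a + 1"
  define H where "H = {\<omega> \<in> Omega. \<forall>i<N. queue_length ((departures ^^ i) \<omega>) n = c (- int a + int i)}"
  have H [measurable]: "H \<in> sets (mu p)"
    unfolding H_def space_mu[of p, symmetric] by measurable
  have bij: "bij_betw (\<lambda>i. - int a + int i) {..<N} ?W"
    by (rule bij_betwI[where g = "\<lambda>k. nat (k + int a)"]) (auto simp: N_def)
  have W: "?W = (\<lambda>i. - int a + int i) ` {..<N}"
    using bij by (simp add: bij_betw_def)
  have "mu.prob (tandem_lengths n -` ?G \<inter> space (mu p)) =
      mu.prob (tandem (- int a) -` H \<inter> space (mu p))"
  proof (rule mu.finite_measure_eq_AE)
    show "AE \<omega> in mu p. \<omega> \<in> tandem_lengths n -` ?G \<inter> space (mu p) \<longleftrightarrow>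
        \<omega> \<in> tandem (- int a) -` H \<inter> space (mu p)"
      using AE_star AE_space
    proof eventually_elim
      case (elim \<omega>)
      have "tandem (- int a) \<omega> \<in> Omega"
        using measurable_space[OF measurable_tandem elim(2)] by (simp add: space_mu)
      then show ?case
        unfolding W using elim tandem_add_nat[OF elim(1), of "- int a", symmetric]
        by (auto simp: H_def space_gamma tandem_lengths_def)
    qed
    have [measurable]: "Measurable.pred (gamma p) (\<lambda>\<alpha>. \<alpha> k = c k)" for k
      by (rule measurable_compose[OF measurable_gamma_coordinate]) simp
    have "?G \<in> sets (gamma p)" by measurable
    then show "tandem_lengths n -` ?G \<inter> space (mu p) \<in> mu.events"
      by (rule measurable_sets[OF measurable_tandem_lengths])
    show "tandem (- int a) -` H \<inter> space (mu p) \<in> mu.events"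
      by (rule measurable_sets[OF measurable_tandem H])
  qed
  also have "\<dots> = measure (distr (mu p) (mu p) (tandem (- int a))) H"
    by (rule measure_distr[symmetric]) measurable
  also have "\<dots> = (\<Prod>i<N. length_prob (c (- int a + int i)))"
    unfolding distr_mu_tandem H_def by (rule prob_tandem_queue_lengths)
  also have "\<dots> = (\<Prod>k\<in>?W. length_prob (c k))"
    by (rule prod.reindex_bij_betw[OF bij])
  finally have "emeasure (distr (mu p) (gamma p) (tandem_lengths n)) ?G =
      ennreal (\<Prod>k\<in>?W. length_prob (c k))"
    by (subst emeasure_distr) (auto simp: mu.emeasure_eq_measure)
  also have "\<dots> = (\<Prod>k\<in>?W. emeasure (measure_pmf (geometric_pmf (1 - rho p))) {c k})"
    by (simp add: emeasure_geometric prod_ennreal length_prob_nonneg)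
  also have "\<dots> = emeasure (gamma p) {\<alpha> \<in> space (gamma p). \<forall>k\<in>?W. \<alpha> k \<in> {c k}}"
    unfolding gamma_def by (rule lengths.emeasure_PiM_Collect[symmetric]) auto
  finally show "emeasure (distr (mu p) (gamma p) (tandem_lengths n))
        {\<alpha> \<in> space (distr (mu p) (gamma p) (tandem_lengths n)). \<forall>k\<in>?W. \<alpha> k = c k} =
      emeasure (gamma p) ?G"
    by simp
qed (auto simp: gamma_def mu.finite_measure_distr[OF measurable_tandem_lengths, unfolded gamma_def])

text \<open>Reconstruction passes through all times, so empty queues are needed at every time \<open>n\<close> and not only
at the time \<open>0\<close> that \<open>\<phi>\<close> records.\<close>

lemma AE_tandem_zeros:
  "AE \<omega> in mu p. \<forall>n k. (\<exists>i. tandem_lengths n \<omega> (k - int i) = 0) \<and>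
    (\<exists>i. tandem_lengths n \<omega> (k + int i) = 0)"
proof -
  have "AE \<omega> in mu p. \<forall>k. (\<exists>i. tandem_lengths n \<omega> (k - int i) = 0) \<and>
      (\<exists>i. tandem_lengths n \<omega> (k + int i) = 0)" for n
  proof (rule AE_distrD[OF measurable_tandem_lengths])
    show "AE \<alpha> in distr (mu p) (gamma p) (tandem_lengths n).
        \<forall>k. (\<exists>i. \<alpha> (k - int i) = 0) \<and> (\<exists>i. \<alpha> (k + int i) = 0)"
      unfolding distr_mu_tandem_lengths by (rule AE_gamma_zeros)
  qed
  then show ?thesis by (simp add: AE_all_countable)
qed

lemma decode_tandem_lengths:
  assumes star: "\<omega> \<in> Omega_star"
    and zeros: "\<forall>n k. (\<exists>i. tandem_lengths n \<omega> (k - int i) = 0) \<and>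
      (\<exists>i. tandem_lengths n \<omega> (k + int i) = 0)"
  shows "decode (tandem_lengths 0 \<omega>) = \<omega>"
proof
  fix n
  have in_star: "tandem k \<omega> \<in> Omega_star" for k
    using pitman_pow[OF star, of k] by simp
  have "decode (tandem_lengths 0 \<omega>) n = tandem 0 \<omega> n"
  proof (rule decode_tandem[where a = "\<lambda>n k. tandem k \<omega> n" and q = "\<lambda>n. tandem_lengths n \<omega>"])
    fix n k
    show "tandem k \<omega> n = -1 \<or> tandem k \<omega> n = 1"
      using in_star[of k] star_Omega1 Omega_cases by (auto simp: Omega1_def)
    show "tandem (k + 1) \<omega> n =
        (if tandem k \<omega> n = -1 \<or> tandem_lengths (n - 1) \<omega> k = 0 then 1 else -1)"
      by (simp add: tandem_add_1[OF star] departures_def tandem_lengths_def)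
    show "tandem_lengths n \<omega> k = (if tandem k \<omega> n = -1 then tandem_lengths (n - 1) \<omega> k + 1
        else tandem_lengths (n - 1) \<omega> k - 1)"
      unfolding tandem_lengths_def using in_star star_Omega1 by (intro queue_length_step) auto
  qed (use zeros in auto)
  then show "decode (tandem_lengths 0 \<omega>) n = \<omega> n"
    by (simp add: tandem_def)
qed

lemma AE_decode_tandem_lengths: "AE \<omega> in mu p. \<omega> \<in> Omega_star \<and> decode (tandem_lengths 0 \<omega>) = \<omega>"
  using AE_star AE_tandem_zeros by eventually_elim (use decode_tandem_lengths in blast)

lemma distr_phi:
  "phi \<in> restrict_space (mu p) Omega_star \<rightarrow>\<^sub>M gamma p"
  "distr (restrict_space (mu p) Omega_star) (gamma p) phi = gamma p"
proof -
  have eq: "phi \<omega> = tandem_lengths 0 \<omega>" if "\<omega> \<in> space (restrict_space (mu p) Omega_star)" for \<omega>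
    using that by (simp add: space_restrict_space phi_eq)
  have tl: "tandem_lengths 0 \<in> restrict_space (mu p) Omega_star \<rightarrow>\<^sub>M gamma p"
    by (intro measurable_restrict_space1 measurable_tandem_lengths)
  then show meas: "phi \<in> restrict_space (mu p) Omega_star \<rightarrow>\<^sub>M gamma p"
    using measurable_cong[of _ phi "tandem_lengths 0" "gamma p", OF eq] by blast
  show "distr (restrict_space (mu p) Omega_star) (gamma p) phi = gamma p"
  proof (rule measure_eqI)
    fix A assume "A \<in> sets (distr (restrict_space (mu p) Omega_star) (gamma p) phi)"
    then have A [measurable]: "A \<in> sets (gamma p)" by simp
    have "emeasure (distr (restrict_space (mu p) Omega_star) (gamma p) phi) A =
        emeasure (mu p) (phi -` A \<inter> Omega_star)"
      using A sets.sets_into_space[OF star_sets]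
      by (simp add: emeasure_distr[OF meas] emeasure_restrict_space space_restrict_space Int_absorb2)
    also have "phi -` A \<inter> Omega_star = (tandem_lengths 0 -` A \<inter> space (mu p)) \<inter> Omega_star"
      using sets.sets_into_space[OF star_sets] by (auto simp: phi_eq)
    also have "emeasure (mu p) \<dots> = emeasure (mu p) (tandem_lengths 0 -` A \<inter> space (mu p))"
      by (rule emeasure_eq_AE) (use AE_star in auto)
    also have "\<dots> = emeasure (gamma p) A"
      using distr_mu_tandem_lengths[of 0] emeasure_distr[OF measurable_tandem_lengths A, of 0]
      by simp
    finally show "emeasure (distr (restrict_space (mu p) Omega_star) (gamma p) phi) A =
        emeasure (gamma p) A" .
  qed simp
qed

section \<open>Injectivity and conjugacy\<close>

lemma ex_injective_set:
  "\<exists>Omega0\<in>sets (mu p). Omega0 \<subseteq> Omega_star \<and> emeasure (mu p) Omega0 = 1 \<and> inj_on phi Omega0"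
proof -
  define Omega0 where "Omega0 = {\<omega> \<in> space (mu p). \<omega> \<in> Omega_star \<and>
    (\<forall>n. decode (tandem_lengths 0 \<omega>) n = \<omega> n)}"
  have [measurable]: "Measurable.pred (mu p) (\<lambda>\<omega>. decode (tandem_lengths 0 \<omega>) n = \<omega> n)" for n
    by (rule measurable_count_space_binary[where h = "(=)"],
        rule measurable_compose[OF _ measurable_coordinate],
        rule measurable_compose[OF measurable_tandem_lengths measurable_decode])
      (rule measurable_coordinate)
  have "Omega0 \<in> sets (mu p)" unfolding Omega0_def by measurable
  moreover have "AE \<omega> in mu p. \<omega> \<in> Omega0"
    using AE_decode_tandem_lengths AE_space
    by eventually_elim (simp add: Omega0_def phi_eq)
  ultimately have "emeasure (mu p) Omega0 = 1"
    by (simp add: mu.emeasure_eq_1_AE)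
  moreover have "inj_on phi Omega0"
    by (rule inj_on_inverseI[where g = decode]) (auto simp: Omega0_def phi_eq)
  ultimately show ?thesis
    using \<open>Omega0 \<in> sets (mu p)\<close> by (intro bexI[of _ Omega0]) (auto simp: Omega0_def)
qed

text \<open>The sequences that \<open>decode\<close> sends into \<open>Omega0\<close> and that are recovered from there form a set \<open>S\<close>
inside the image; it is measurable because \<open>decode\<close> is, and \<open>\<phi> \<omega>\<close> lies in it almost surely.\<close>

lemma AE_gamma_image_phi:
  assumes [measurable]: "Omega0 \<in> sets (mu p)" and sub: "Omega0 \<subseteq> Omega_star"
    and AE: "AE \<omega> in mu p. \<omega> \<in> Omega0"
  shows "AE \<alpha> in gamma p. \<alpha> \<in> phi ` Omega0"
proof -
  define S where "S = {\<alpha> \<in> space (gamma p). decode \<alpha> \<in> Omega0 \<and>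
    (\<forall>k. tandem_lengths 0 (decode \<alpha>) k = \<alpha> k)}"
  have [measurable]: "Measurable.pred (gamma p) (\<lambda>\<alpha>. tandem_lengths 0 (decode \<alpha>) k = \<alpha> k)" for k
    by (rule measurable_count_space_binary[where h = "(=)"],
        rule measurable_compose[OF _ measurable_gamma_coordinate],
        rule measurable_compose[OF measurable_decode measurable_tandem_lengths])
      (rule measurable_gamma_coordinate)
  have S: "{\<alpha> \<in> space (gamma p). \<alpha> \<in> S} \<in> sets (gamma p)"
    unfolding S_def by measurable
  have "AE \<omega> in mu p. tandem_lengths 0 \<omega> \<in> S"
    using AE_decode_tandem_lengths AE
  proof eventually_elim
    case (elim \<omega>)
    then show ?case by (simp add: S_def space_gamma phi_eq)
  qed
  then have "AE \<alpha> in distr (mu p) (gamma p) (tandem_lengths 0). \<alpha> \<in> S"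
    by (simp add: AE_distr_iff[OF measurable_tandem_lengths S])
  then have "AE \<alpha> in gamma p. \<alpha> \<in> S"
    unfolding distr_mu_tandem_lengths .
  then show ?thesis
  proof eventually_elim
    case (elim \<alpha>)
    then have "decode \<alpha> \<in> Omega0" "tandem_lengths 0 (decode \<alpha>) = \<alpha>"
      by (auto simp: S_def)
    then have "decode \<alpha> \<in> Omega0" "phi (decode \<alpha>) = \<alpha>"
      using sub by (auto simp: phi_eq)
    then show ?case by (metis imageI)
  qed
qed

text \<open>Invariance of \<open>\<mu>\<close> puts \<open>T \<omega>\<close> into \<open>Omega0\<close> almost surely, where \<open>\<phi>\<close> may be inverted at
\<open>\<theta> (\<phi> \<omega>) = \<phi> (T \<omega>)\<close>.\<close>

lemma AE_pitman_conjugate: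
  assumes [measurable]: "Omega0 \<in> sets (mu p)" and sub: "Omega0 \<subseteq> Omega_star"
    and AE: "AE \<omega> in mu p. \<omega> \<in> Omega0" and inj: "inj_on phi Omega0"
  shows "AE \<omega> in mu p. \<omega> \<in> Omega_star \<and> theta (phi \<omega>) \<in> phi ` Omega0 \<and>
    pitman \<omega> = inv_into Omega0 phi (theta (phi \<omega>))"
proof -
  have "AE \<omega> in distr (mu p) (mu p) departures. \<omega> \<in> Omega0"
    unfolding distr_mu_departures by (rule AE)
  then have "AE \<omega> in mu p. departures \<omega> \<in> Omega0"
    by (rule AE_distrD[OF measurable_departures])
  then show ?thesis
    using AE_star
  proof eventually_elim
    case (elim \<omega>)
    then have "pitman \<omega> \<in> Omega0" by (simp add: pitman_eq)
    then show ?case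
      using elim inj by (simp add: theta_phi inv_into_f_f)
  qed
qed

end

theorem theorem2p2:
  fixes p :: real and Omega_star :: "(int \<Rightarrow> int) set"
  assumes "1/2 < p" and "p \<le> 1"
    and "Omega_star \<in> sets (mu p)"
    and "Omega_star \<subseteq> Omega2"
    and "emeasure (mu p) Omega_star = 1"
    and "bij_betw pitman Omega_star Omega_star"
    and "\<forall>\<omega>\<in>Omega_star. pitman_inv (pitman \<omega>) = \<omega>"
  shows
    "(phi \<in> restrict_space (mu p) Omega_star \<rightarrow>\<^sub>M gamma p \<and>
      distr (restrict_space (mu p) Omega_star) (gamma p) phi = gamma p) \<and>
     (\<exists>Omega0\<in>sets (mu p).
        Omega0 \<subseteq> Omega_star \<and> emeasure (mu p) Omega0 = 1 \<and> inj_on phi Omega0) \<and>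
     (\<forall>Omega0\<in>sets (mu p).
        Omega0 \<subseteq> Omega_star \<and> emeasure (mu p) Omega0 = 1 \<and> inj_on phi Omega0 \<longrightarrow>
          (AE \<alpha> in gamma p. \<alpha> \<in> phi ` Omega0) \<and>
          (AE \<omega> in mu p. \<omega> \<in> Omega_star \<and> theta (phi \<omega>) \<in> phi ` Omega0 \<and>
             pitman \<omega> = inv_into Omega0 phi (theta (phi \<omega>))))"
proof -
  interpret mu: prob_space "mu p"
    unfolding mu_def using assms(1,2) by (intro prob_space_PiM prob_space_step_measure) auto
  have AE_star: "AE \<omega> in mu p. \<omega> \<in> Omega_star"
    using assms(3,5) by (simp add: mu.AE_in_set_eq_1 mu.emeasure_eq_measure)
  have star_Omega1: "Omega_star \<subseteq> Omega1"
    using assms(4) by (auto simp: Omega2_def)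
  interpret pitman_system p Omega_star
  proof unfold_locales
    show "AE \<omega> in mu p. \<omega> \<in> Omega1"
      using AE_star by eventually_elim (use star_Omega1 in auto)
  qed (use assms AE_star star_Omega1 in auto)
  have AE_Omega0: "AE \<omega> in mu p. \<omega> \<in> Omega0"
    if "Omega0 \<in> sets (mu p)" "emeasure (mu p) Omega0 = 1" for Omega0
    using that by (simp add: mu.AE_in_set_eq_1 mu.emeasure_eq_measure)
  show ?thesis
    using distr_phi ex_injective_set AE_gamma_image_phi AE_pitman_conjugate AE_Omega0 by simp
qed

end
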